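(* Let $R$ be a commutative Noetherian ring with unit, let $S$ be a finite set of ideals of $R$, and let $g\ge 0$ be a fixed integer. Then the $\mathcal{G}_{g,S}^{\mathrm{op}}$-module $\mathrm{Spl}_R$ is finitely generated. In particular, there exists a finite set $\{(G_i,\alpha_i)\}_i$ of edge-labeled graphs of genus $g$, depending only on $R$, $S$ and $g$, such that for every edge-labeled graph $(G,\alpha)$ of genus $g$ (with labels in $S$), the module of generalized splines $\mathrm{Spl}_R(G,\alpha)$ is generated as an $R$-module by the images of the modules $\mathrm{Spl}_R(G_i,\alpha_i)$ under the maps $\varphi^*$ induced by contractions $\varphi\colon(G,\alpha)\to(G_i,\alpha_i)$.
   Context: A graph $G$ consists of a finite vertex set $V_G$, a finite edge set $E_G$, and a boundary map $\partial$ sending each edge to its endpoints (an unordered pair of distinct vertices, or a single vertex if the edge is a loop) and each vertex to itself; multiple edges and loops are allowed. All graphs are connected. The (combinatorial) genus is $g=|E_G|-|V_G|+1$. An edge-labeled graph is a pair $(G,\alpha)$ with $\alpha\colon E_G\to S$ a map. A contraction $(G,\alpha)\to(G',\alpha')$ is a map $\varphi\colon V_G\sqcup E_G\to V_{G'}\sqcup E_{G'}$ such that: (1) $\varphi(V_G)=V_{G'}$; (2) $\varphi(\partial(e))=\partial(\varphi(e))$ for all $e\in E_G$ (where a pair of endpoints with the same image is identified with that single vertex); (3) $\varphi$ restricts to a bijection $\varphi^{-1}(E_{G'})\to E_{G'}$, and $\alpha'(\varphi(e))=\alpha(e)$ for all $e\in\varphi^{-1}(E_{G'})$; (4) for every $v\in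 V_{G'}$, the preimage $\varphi^{-1}(v)$ is a subtree of $G$. $\mathcal{G}_{g,S}$ is the category of edge-labeled graphs of genus $g$ with labels in $S$, with contractions as morphisms. A $\mathcal{G}_{g,S}^{\mathrm{op}}$-module over $R$ is a covariant functor $M$ from $\mathcal{G}_{g,S}^{\mathrm{op}}$ to finitely generated $R$-modules. It is finitely generated if there is a finite list of objects $(G_i,\alpha_i)$ such that for every object $(G,\alpha)$, $M(G,\alpha)$ is spanned by the images of the $M(G_i,\alpha_i)$ under the maps induced by contractions $(G,\alpha)\to(G_i,\alpha_i)$. The module of generalized splines $\mathrm{Spl}_R(G,\alpha)$ is the $R$-submodule of $\bigoplus_{v\in V_G}R$ of all $\mathbf p$ with $\mathbf p_u-\mathbf p_v\in\alpha(e)$ for every edge $e$ with $\partial(e)=\{u,v\}$. A contraction $\varphi\colon(G,\alpha)\to(G',\alpha')$ induces $\varphi^*\colon\mathrm{Spl}_R(G',\alpha')\to\mathrm{Spl}_R(G,\alpha)$, $(\mathbf p_v)_{v\in V_{G'}}\mapsto(\mathbf p_{\varphi(w)})_{w\in V_G}$. These maps make $(G,\alpha)\mapsto\mathrm{Spl}_R(G,\alpha)$ into a $\mathcal{G}_{g,S}^{\mathrm{op}}$-module, denoted $\mathrm{Spl}_R$. *)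

theory Defs
  imports "HOL-Algebra.Module" "HOL-Algebra.Ring_Divisibility"
begin

section \<open>Graphs\<close>

text \<open>
  Multigraphs with loops. The field \<open>ends\<close> gives the boundary of an edge as a set of vertices:
  it has two elements for an ordinary edge and one element for a loop.
\<close>

record ('v, 'e) graph =
  verts :: "'v set"
  edges :: "'e set"
  ends :: "'e \<Rightarrow> 'v set"

record ('v, 'e, 's) lgraph = "('v, 'e) graph" +
  label :: "'e \<Rightarrow> 's"

definition wf_graph :: "('v, 'e, 'x) graph_scheme \<Rightarrow> bool" where
  "wf_graph G \<longleftrightarrow> finite (verts G) \<and> finite (edges G) \<and>
     (\<forall>e\<in>edges G. \<exists>u\<in>verts G. \<exists>v\<in>verts G. ends G e = {u, v})"

definition adj :: "('v, 'e, 'x) graph_scheme \<Rightarrow> ('v \<times> 'v) set" where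
  "adj G = {(u, v). \<exists>e\<in>edges G. ends G e = {u, v}}"

definition connected_graph :: "('v, 'e, 'x) graph_scheme \<Rightarrow> bool" where
  "connected_graph G \<longleftrightarrow> wf_graph G \<and> verts G \<noteq> {} \<and>
     (\<forall>u\<in>verts G. \<forall>v\<in>verts G. (u, v) \<in> (adj G)\<^sup>*)"

definition genus :: "('v, 'e, 'x) graph_scheme \<Rightarrow> int" where
  "genus G = int (card (edges G)) - int (card (verts G)) + 1"

text \<open>
  A cycle consists of \<open>n \<ge> 1\<close> distinct vertices and \<open>n\<close> distinct edges, the \<open>i\<close>-th edge joining
  the \<open>i\<close>-th vertex to the cyclically next one. Loops (\<open>n = 1\<close>) and pairs of parallel edges
  (\<open>n = 2\<close>) are cycles.
\<close>

definition cycle :: "('v, 'e, 'x) graph_scheme \<Rightarrow> 'v list \<Rightarrow> 'e list \<Rightarrow> bool" where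
  "cycle G vs es \<longleftrightarrow> es \<noteq> [] \<and> length vs = length es \<and> distinct vs \<and> distinct es \<and>
     set vs \<subseteq> verts G \<and> set es \<subseteq> edges G \<and>
     (\<forall>i<length es. ends G (es ! i) = {vs ! i, vs ! (Suc i mod length es)})"

definition tree :: "('v, 'e, 'x) graph_scheme \<Rightarrow> bool" where
  "tree G \<longleftrightarrow> connected_graph G \<and> (\<nexists>vs es. cycle G vs es)"


section \<open>Contractions\<close>

text \<open>The disjoint union of the vertex set (\<open>Inl\<close>) and the edge set (\<open>Inr\<close>).\<close>

definition cells :: "('v, 'e, 'x) graph_scheme \<Rightarrow> ('v + 'e) set" where
  "cells G = verts G <+> edges G"

fun bdry :: "('v, 'e, 'x) graph_scheme \<Rightarrow> 'v + 'e \<Rightarrow> ('v + 'e) set" where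
  "bdry G (Inl v) = {Inl v}"
| "bdry G (Inr e) = Inl ` ends G e"

text \<open>
  That a set of cells is a subgraph at all, i.e. contains the endpoints of its edges, is part
  of the well-formedness required by \<^const>\<open>tree\<close>.
\<close>

definition subtree :: "('v, 'e, 'x) graph_scheme \<Rightarrow> ('v + 'e) set \<Rightarrow> bool" where
  "subtree G A \<longleftrightarrow> A \<subseteq> cells G \<and>
     tree (G\<lparr>verts := {v. Inl v \<in> A}, edges := {e. Inr e \<in> A}\<rparr>)"

text \<open>
  Contractions are extensional functions, so that two of them are equal as soon as they agree
  on the cells of the source.
\<close>

definition contraction ::
  "('v, 'e, 's) lgraph \<Rightarrow> ('w, 'f, 's) lgraph \<Rightarrow> ('v + 'e \<Rightarrow> 'w + 'f) \<Rightarrow> bool" where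
  "contraction G G' \<phi> \<longleftrightarrow>
     \<phi> \<in> cells G \<rightarrow>\<^sub>E cells G' \<and>
     \<phi> ` (Inl ` verts G) = Inl ` verts G' \<and>
     (\<forall>e\<in>edges G. \<phi> ` bdry G (Inr e) = bdry G' (\<phi> (Inr e))) \<and>
     bij_betw \<phi> {x \<in> cells G. \<phi> x \<in> Inr ` edges G'} (Inr ` edges G') \<and>
     (\<forall>e\<in>edges G. \<forall>e'\<in>edges G'. \<phi> (Inr e) = Inr e' \<longrightarrow> label G' e' = label G e) \<and>
     (\<forall>v\<in>verts G'. subtree G {x \<in> cells G. \<phi> x = Inl v})"

text \<open>
  The objects are the graphs with vertices in \<open>'v\<close> and edges in \<open>'e\<close>. If both types are infinite,
  e.g. \<open>nat\<close>, every finite graph is isomorphic to one of these. Values of \<open>label\<close> outside the edge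
  set are irrelevant.
\<close>

definition labeled_graphs :: "nat \<Rightarrow> 's set \<Rightarrow> ('v, 'e, 's) lgraph set" where
  "labeled_graphs g S =
     {G. connected_graph G \<and> genus G = int g \<and> label G \<in> edges G \<rightarrow> S}"


section \<open>Modules over a ring\<close>

definition module_span ::
  "('a, 'b) ring_scheme \<Rightarrow> ('a, 'm, 'c) module_scheme \<Rightarrow> 'm set \<Rightarrow> 'm set" where
  "module_span R M X = \<Inter>{N. submodule N R M \<and> X \<subseteq> N}"

definition fg_module :: "('a, 'b) ring_scheme \<Rightarrow> ('a, 'm, 'c) module_scheme \<Rightarrow> bool" where
  "fg_module R M \<longleftrightarrow> module R M \<and>
     (\<exists>X. finite X \<and> X \<subseteq> carrier M \<and> module_span R M X = carrier M)"

definition module_hom ::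
  "('a, 'b) ring_scheme \<Rightarrow> ('a, 'm, 'c) module_scheme \<Rightarrow> ('a, 'n, 'd) module_scheme
     \<Rightarrow> ('m \<Rightarrow> 'n) set" where
  "module_hom R M N = {f \<in> carrier M \<rightarrow> carrier N.
     (\<forall>x\<in>carrier M. \<forall>y\<in>carrier M. f (x \<oplus>\<^bsub>M\<^esub> y) = f x \<oplus>\<^bsub>N\<^esub> f y) \<and>
     (\<forall>a\<in>carrier R. \<forall>x\<in>carrier M. f (a \<odot>\<^bsub>M\<^esub> x) = a \<odot>\<^bsub>N\<^esub> f x)}"


section \<open>Modules over the opposite of the contraction category\<close>

text \<open>
  A functor is given by its values \<open>M G\<close> on objects and the maps \<open>F G G' \<phi> : M G' \<rightarrow> M G\<close>
  induced by contractions \<open>\<phi> : G \<rightarrow> G'\<close>. Only the values of these maps on the carriers matter.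
\<close>

definition gop_module ::
  "('a, 'b) ring_scheme \<Rightarrow> nat \<Rightarrow> 's set
     \<Rightarrow> (('v, 'e, 's) lgraph \<Rightarrow> ('a, 'm, 'c) module_scheme)
     \<Rightarrow> (('v, 'e, 's) lgraph \<Rightarrow> ('v, 'e, 's) lgraph \<Rightarrow> ('v + 'e \<Rightarrow> 'v + 'e) \<Rightarrow> 'm \<Rightarrow> 'm)
     \<Rightarrow> bool" where
  "gop_module R g S M F \<longleftrightarrow>
     (\<forall>G\<in>labeled_graphs g S. fg_module R (M G)) \<and>
     (\<forall>G\<in>labeled_graphs g S. \<forall>G'\<in>labeled_graphs g S. \<forall>\<phi>.
        contraction G G' \<phi> \<longrightarrow> F G G' \<phi> \<in> module_hom R (M G') (M G)) \<and>
     (\<forall>G\<in>labeled_graphs g S. \<forall>x\<in>carrier (M G). F G G (\<lambda>c\<in>cells G. c) x = x) \<and>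
     (\<forall>G\<in>labeled_graphs g S. \<forall>G'\<in>labeled_graphs g S. \<forall>G''\<in>labeled_graphs g S. \<forall>\<phi> \<psi>.
        contraction G G' \<phi> \<longrightarrow> contraction G' G'' \<psi> \<longrightarrow>
          (\<forall>x\<in>carrier (M G''). F G G'' (compose (cells G) \<psi> \<phi>) x = F G G' \<phi> (F G' G'' \<psi> x)))"

definition fg_gop_module ::
  "('a, 'b) ring_scheme \<Rightarrow> nat \<Rightarrow> 's set
     \<Rightarrow> (('v, 'e, 's) lgraph \<Rightarrow> ('a, 'm, 'c) module_scheme)
     \<Rightarrow> (('v, 'e, 's) lgraph \<Rightarrow> ('v, 'e, 's) lgraph \<Rightarrow> ('v + 'e \<Rightarrow> 'v + 'e) \<Rightarrow> 'm \<Rightarrow> 'm)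
     \<Rightarrow> bool" where
  "fg_gop_module R g S M F \<longleftrightarrow> gop_module R g S M F \<and>
     (\<exists>\<G>. finite \<G> \<and> \<G> \<subseteq> labeled_graphs g S \<and>
       (\<forall>G\<in>labeled_graphs g S.
          module_span R (M G) (\<Union>G'\<in>\<G>. \<Union>\<phi>\<in>{\<phi>. contraction G G' \<phi>}. F G G' \<phi> ` carrier (M G'))
            = carrier (M G)))"


section \<open>Generalized splines\<close>

text \<open>
  The direct sum of copies of \<open>R\<close> indexed by a finite set \<open>V\<close>, as extensional functions on \<open>V\<close>.
  The fields \<open>mult\<close> and \<open>one\<close>, which a module record inherits from rings, play no role.
\<close>

definition power_module :: "('a, 'b) ring_scheme \<Rightarrow> 'v set \<Rightarrow> ('a, 'v \<Rightarrow> 'a) module" where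
  "power_module R V =
     \<lparr>carrier = V \<rightarrow>\<^sub>E carrier R,
      mult = (\<lambda>p q. \<lambda>v\<in>V. p v \<otimes>\<^bsub>R\<^esub> q v),
      one = (\<lambda>v\<in>V. \<one>\<^bsub>R\<^esub>),
      zero = (\<lambda>v\<in>V. \<zero>\<^bsub>R\<^esub>),
      add = (\<lambda>p q. \<lambda>v\<in>V. p v \<oplus>\<^bsub>R\<^esub> q v),
      smult = (\<lambda>a p. \<lambda>v\<in>V. a \<otimes>\<^bsub>R\<^esub> p v)\<rparr>"

definition Spl ::
  "('a, 'b) ring_scheme \<Rightarrow> ('v, 'e, 'a set) lgraph \<Rightarrow> ('a, 'v \<Rightarrow> 'a) module" where
  "Spl R G = (power_module R (verts G))
     \<lparr>carrier := {p \<in> carrier (power_module R (verts G)).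
        \<forall>e\<in>edges G. \<forall>u v. ends G e = {u, v} \<longrightarrow> p u \<ominus>\<^bsub>R\<^esub> p v \<in> label G e}\<rparr>"

text \<open>The pullback of splines; a contraction maps vertices to vertices, so \<open>projl\<close> is harmless.\<close>

definition Spl_map ::
  "('v, 'e, 's) lgraph \<Rightarrow> ('w, 'f, 's) lgraph \<Rightarrow> ('v + 'e \<Rightarrow> 'w + 'f)
     \<Rightarrow> ('w \<Rightarrow> 'a) \<Rightarrow> ('v \<Rightarrow> 'a)" where
  "Spl_map G G' \<phi> p = (\<lambda>w\<in>verts G. p (projl (\<phi> (Inl w))))"

end

theory Submission
  imports Defs
begin

text \<open>
  Choose a rooted spanning tree of \<open>G\<close>. A spline is determined by its value at the root and its
  jumps along the tree edges; the remaining conditions come from the \<open>g\<close> other edges, which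
  have at most \<open>2 * g\<close> endpoints in total. For these conditions, only the ideal of a tree edge and the
  set of those endpoints below it matter, so there are at most \<open>card S * 2 ^ (2 * g)\<close> types of tree
  edges. By moving jumps between edges of the same type, every spline becomes a sum of splines with
  boundedly many jumps. Contracting all tree edges without a jump exhibits each summand as a pullback
  from a graph of bounded size, and such graphs form finitely many isomorphism classes. The ring being
  Noetherian is needed only for the values of the functor to be finitely generated.
\<close>

section \<open>Spline modules\<close>

text \<open>A single jump cannot in general be split off: the function equal to \<open>a\<close>
  below one tree edge and 0 elsewhere meets the condition at an outside edge leaving that set only
  if \<open>a\<close> also lies in the ideal of this edge. Two tree edges of the same type separate
  the outside endpoints in the same way, so the difference of two such functions vanishes at all of
  them. This is why jumps are moved in pairs and why types are counted. A spline is a pullback only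
  if it is constant on the fibres, and fibres have to be trees. Hence only pieces of the spanning
  tree without jumps are collapsed, while every outside edge is kept, possibly as a loop. The
  quotient has the root and one vertex per jump, and the fixed genus then bounds its edges. Since
  objects live in the fixed types \<open>'v\<close> and \<open>'e\<close>, each such quotient is
  replaced by a chosen isomorphic object.\<close>

lemma (in cring) submodule_iff_closed:
  assumes "module R M"
  shows "submodule N R M \<longleftrightarrow> N \<subseteq> carrier M \<and> N \<noteq> {} \<and>
    (\<forall>x\<in>N. \<forall>y\<in>N. x \<oplus>\<^bsub>M\<^esub> y \<in> N) \<and> (\<forall>a\<in>carrier R. \<forall>x\<in>N. a \<odot>\<^bsub>M\<^esub> x \<in> N)"
    (is "_ \<longleftrightarrow> ?closed")
proof
  interpret M: module R M by fact
  show ?closed if "submodule N R M"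
    using M.submoduleE[OF that] by simp
  assume closed: ?closed
  \<comment> \<open>Negation is multiplication by -1, so closure under scalars supplies inverses,
    and nonemptiness then supplies zero.\<close>
  have inv: "\<ominus>\<^bsub>M\<^esub> x \<in> N" if "x \<in> N" for x
  proof -
    have "(\<ominus> \<one>) \<odot>\<^bsub>M\<^esub> x = \<ominus>\<^bsub>M\<^esub> x"
      using that closed by (subst M.smult_l_minus) auto
    moreover have "(\<ominus> \<one>) \<odot>\<^bsub>M\<^esub> x \<in> N"
      using that closed by blast
    ultimately show ?thesis by simp
  qed
  obtain x where "x \<in> N" using closed by blast
  hence "x \<oplus>\<^bsub>M\<^esub> \<ominus>\<^bsub>M\<^esub> x \<in> N" "x \<in> carrier M" using closed inv by auto
  hence "\<zero>\<^bsub>M\<^esub> \<in> N" by (simp add: M.r_neg)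
  thus "submodule N R M"
    using closed inv by (intro M.submoduleI) auto
qed

section \<open>Power modules and their submodules over a Noetherian ring\<close>

lemma power_module_simps [simp]:
  "carrier (power_module R V) = V \<rightarrow>\<^sub>E carrier R"
  "p \<oplus>\<^bsub>power_module R V\<^esub> q = (\<lambda>v\<in>V. p v \<oplus>\<^bsub>R\<^esub> q v)"
  "\<zero>\<^bsub>power_module R V\<^esub> = (\<lambda>v\<in>V. \<zero>\<^bsub>R\<^esub>)"
  "a \<odot>\<^bsub>power_module R V\<^esub> p = (\<lambda>v\<in>V. a \<otimes>\<^bsub>R\<^esub> p v)"
  by (simp_all add: power_module_def)

lemma (in cring) module_power_module: "module R (power_module R V)"
proof (rule moduleI)
  show "abelian_group (power_module R V)"
  proof (rule abelian_groupI)
    fix p assume "p \<in> carrier (power_module R V)"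
    thus "\<exists>q\<in>carrier (power_module R V). q \<oplus>\<^bsub>power_module R V\<^esub> p = \<zero>\<^bsub>power_module R V\<^esub>"
      by (intro bexI[of _ "\<lambda>v\<in>V. \<ominus> p v"])
        (auto simp: PiE_iff fun_eq_iff l_neg intro!: ext)
  qed (auto simp: PiE_iff extensional_def fun_eq_iff a_assoc intro: a_comm)
qed (auto simp: PiE_iff extensional_def fun_eq_iff l_distr r_distr m_assoc is_cring)

text \<open>A coordinate is a linear map to the ring, and submodules of the ring are its ideals.
  This turns the Noetherian hypothesis on ideals into information about one coordinate of a
  submodule.\<close>

lemma (in cring) ideal_evaluation:
  assumes "submodule N R (power_module R V)" and "w \<in> V"
  shows "ideal ((\<lambda>p. p w) ` N) R"
proof -
  let ?I = "(\<lambda>p. p w) ` N"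
  have N: "N \<subseteq> V \<rightarrow>\<^sub>E carrier R" "N \<noteq> {}"
    "\<And>p q. p \<in> N \<Longrightarrow> q \<in> N \<Longrightarrow> (\<lambda>v\<in>V. p v \<oplus> q v) \<in> N"
    "\<And>a p. a \<in> carrier R \<Longrightarrow> p \<in> N \<Longrightarrow> (\<lambda>v\<in>V. a \<otimes> p v) \<in> N"
    using assms(1) unfolding submodule_iff_closed[OF module_power_module] by auto
  have carr: "p w \<in> carrier R" if "p \<in> N" for p
    using N(1) that assms(2) by (auto simp: PiE_iff)
  have mult: "a \<otimes> x \<in> ?I" if a: "a \<in> carrier R" and x: "x \<in> ?I" for a x
  proof -
    obtain p where p: "p \<in> N" "x = p w" using x by blast
    show ?thesis using N(4)[OF a p(1)] p(2) assms(2) by (force intro: rev_image_eqI)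
  qed
  have add: "x \<oplus> y \<in> ?I" if x: "x \<in> ?I" and y: "y \<in> ?I" for x y
  proof -
    obtain p q where p: "p \<in> N" "x = p w" "q \<in> N" "y = q w" using x y by blast
    show ?thesis using N(3)[OF p(1,3)] p(2,4) assms(2) by (force intro: rev_image_eqI)
  qed
  show ?thesis
  proof (rule idealI)
    show "subgroup ?I (add_monoid R)"
    proof (rule add.subgroupI)
      fix x assume x: "x \<in> ?I"
      have "(\<ominus> \<one>) \<otimes> x = \<ominus> x" using x carr by (auto simp: l_minus)
      thus "\<ominus> x \<in> ?I" using mult[OF _ x, of "\<ominus> \<one>"] by simp
    qed (use N(2) carr add in auto)
    show "a \<otimes> x \<in> ?I" if "x \<in> ?I" "a \<in> carrier R" for a x
      using mult that by blast
    show "x \<otimes> a \<in> ?I" if "x \<in> ?I" "a \<in> carrier R" for a x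
      using mult[OF that(2,1)] that carr by (auto simp: m_comm)
  qed (rule ring_axioms)
qed

text \<open>Induction on the set \<open>W\<close> of coordinates that may be nonzero: the elements
  vanishing at \<open>w\<close> fall under the induction hypothesis, and finitely many further
  elements are lifts of generators of the ideal of values at \<open>w\<close>. All functions keep
  the domain \<open>V\<close>, so that the submodules compared lie in one module. Generation is
  expressed by minimality, which matches the intersection in \<open>module_span\<close>.\<close>

lemma submodule_power_module_fg:
  fixes R (structure)
  assumes "cring R" and "noetherian_ring R"
    and "finite W" and "W \<subseteq> V" and "submodule N R (power_module R V)"
    and "\<forall>p\<in>N. \<forall>v\<in>V - W. p v = \<zero>"
  shows "\<exists>X. finite X \<and> X \<subseteq> N \<and>
    (\<forall>N'. submodule N' R (power_module R V) \<longrightarrow> X \<subseteq> N' \<longrightarrow> N \<subseteq> N')"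
  using assms(3-)
proof (induction W arbitrary: N rule: finite_induct)
  interpret cring R by fact
  note sub_iff = submodule_iff_closed[OF module_power_module]
  case empty
  have "p = (\<lambda>v\<in>V. \<zero>)" if "p \<in> N" for p
  proof
    show "p v = (\<lambda>v\<in>V. \<zero>) v" for v
      using that empty by (cases "v \<in> V") (auto simp: sub_iff PiE_iff extensional_def)
  qed
  moreover have "(\<lambda>v\<in>V. \<zero>) \<in> N'" if "submodule N' R (power_module R V)" for N'
    using subgroup.one_closed[OF submodule.axioms(1)[OF that]] by simp
  ultimately show ?case by (intro exI[of _ "{}"]) auto
next
  interpret cring R by fact
  note sub_iff = submodule_iff_closed[OF module_power_module]
  case (insert w W)
  have w: "w \<in> V" using insert by blast
  define N0 where "N0 = {p \<in> N. p w = \<zero>}"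
  note N = insert.prems(2)[unfolded sub_iff]
  have N_add: "(\<lambda>v\<in>V. x v \<oplus> y v) \<in> N" if "x \<in> N" "y \<in> N" for x y
    using N that by simp
  have zero: "(\<lambda>v\<in>V. \<zero>) \<in> N'" if "submodule N' R (power_module R V)" for N'
    using subgroup.one_closed[OF submodule.axioms(1)[OF that]] by simp
  have N0: "submodule N0 R (power_module R V)"
    using N zero[OF insert.prems(2)] w unfolding sub_iff N0_def by auto
  have "\<forall>p\<in>N0. \<forall>v\<in>V - W. p v = \<zero>"
    using insert.prems(3) by (auto simp: N0_def)
  then obtain X0 where X0: "finite X0" "X0 \<subseteq> N0"
    "\<And>N'. submodule N' R (power_module R V) \<Longrightarrow> X0 \<subseteq> N' \<Longrightarrow> N0 \<subseteq> N'"
    using insert.IH[OF _ N0] insert.prems(1) by auto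
  obtain A where A: "A \<subseteq> carrier R" "finite A" "(\<lambda>p. p w) ` N = Idl A"
    using noetherian_ring.finetely_gen[OF assms(2) ideal_evaluation[OF insert.prems(2) w]] by blast
  have "A \<subseteq> (\<lambda>p. p w) ` N" using genideal_self[OF A(1)] A(3) by simp
  then obtain X1 where X1: "X1 \<subseteq> N" "finite X1" "(\<lambda>p. p w) ` X1 = A"
    using finite_subset_image[OF A(2), of "\<lambda>p. p w" N] by blast
  have "N \<subseteq> N'" if N': "submodule N' R (power_module R V)" and X: "X0 \<union> X1 \<subseteq> N'" for N'
  proof
    fix p assume p: "p \<in> N"
    note N'c = N'[unfolded sub_iff]
    have N'_add: "(\<lambda>v\<in>V. x v \<oplus> y v) \<in> N'" if "x \<in> N'" "y \<in> N'" for x y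
      using N'c that by simp
    \<comment> \<open>Evaluating the intersection yields \<open>q\<close> in both submodules:
      membership in \<open>N\<close> puts \<open>p - q\<close> into \<open>N0\<close>, and
      membership in \<open>N'\<close> allows \<open>q\<close> to be added back.\<close>
    have "submodule (N \<inter> N') R (power_module R V)"
      using N N'c zero[OF N'] zero[OF insert.prems(2)] unfolding sub_iff by auto
    hence "ideal ((\<lambda>p. p w) ` (N \<inter> N')) R" by (rule ideal_evaluation[OF _ w])
    moreover have "A \<subseteq> (\<lambda>p. p w) ` (N \<inter> N')" using X1 X by auto
    ultimately have "(\<lambda>p. p w) ` N \<subseteq> (\<lambda>p. p w) ` (N \<inter> N')"
      unfolding A(3) by (rule genideal_minimal)
    then obtain q where q: "q \<in> N" "q \<in> N'" "q w = p w" using p by force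
    have carr: "p v \<in> carrier R" "q v \<in> carrier R" if "v \<in> V" for v
      using p q that N by (auto simp: PiE_iff)
    let ?d = "(\<lambda>v\<in>V. p v \<oplus> (\<ominus> \<one>) \<otimes> q v)"
    have "(\<lambda>v\<in>V. (\<ominus> \<one>) \<otimes> q v) \<in> N" using N q by simp
    hence "(\<lambda>v\<in>V. p v \<oplus> (\<lambda>v\<in>V. (\<ominus> \<one>) \<otimes> q v) v) \<in> N" by (rule N_add[OF p])
    also have "(\<lambda>v\<in>V. p v \<oplus> (\<lambda>v\<in>V. (\<ominus> \<one>) \<otimes> q v) v) = ?d" by auto
    finally have "?d \<in> N" .
    moreover have "?d w = \<zero>" using w q carr by (simp add: l_minus r_neg)
    ultimately have "?d \<in> N'" using X0(3)[OF N'] X by (auto simp: N0_def)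
    hence "(\<lambda>v\<in>V. ?d v \<oplus> q v) \<in> N'" by (rule N'_add[OF _ q(2)])
    also have "(\<lambda>v\<in>V. ?d v \<oplus> q v) = p"
    proof
      show "(\<lambda>v\<in>V. ?d v \<oplus> q v) v = p v" for v
        using carr p N by (cases "v \<in> V")
          (auto simp: l_minus a_assoc l_neg PiE_iff extensional_def)
    qed
    finally show "p \<in> N'" .
  qed
  moreover have "X0 \<union> X1 \<subseteq> N" using X0(2) X1(1) by (auto simp: N0_def)
  moreover have "finite (X0 \<union> X1)" using X0 X1 by simp
  ultimately show ?case by blast
qed

section \<open>Splines as a submodule of a power module\<close>

lemma Spl_simps [simp]:
  "carrier (Spl R G) = {p \<in> verts G \<rightarrow>\<^sub>E carrier R.
     \<forall>e\<in>edges G. \<forall>u v. ends G e = {u, v} \<longrightarrow> p u \<ominus>\<^bsub>R\<^esub> p v \<in> label G e}"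
  "p \<oplus>\<^bsub>Spl R G\<^esub> q = (\<lambda>v\<in>verts G. p v \<oplus>\<^bsub>R\<^esub> q v)"
  "\<zero>\<^bsub>Spl R G\<^esub> = (\<lambda>v\<in>verts G. \<zero>\<^bsub>R\<^esub>)"
  "a \<odot>\<^bsub>Spl R G\<^esub> p = (\<lambda>v\<in>verts G. a \<otimes>\<^bsub>R\<^esub> p v)"
  by (simp_all add: Spl_def power_module_def)

lemma wf_graph_ends:
  assumes "wf_graph G" and "e \<in> edges G" and "ends G e = {u, v}"
  shows "u \<in> verts G" and "v \<in> verts G"
  using assms unfolding wf_graph_def by (metis doubleton_eq_iff)+

lemma (in cring) submodule_Spl:
  assumes "wf_graph G" and "\<forall>e\<in>edges G. ideal (label G e) R"
  shows "submodule (carrier (Spl R G)) R (power_module R (verts G))"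
proof -
  have 1: "(\<lambda>v\<in>verts G. \<zero>) \<in> carrier (Spl R G)"
    using assms wf_graph_ends[OF assms(1)]
    by (auto simp: r_neg minus_eq additive_subgroup.zero_closed ideal.axioms(1))
  have 2: "(\<lambda>v\<in>verts G. p v \<oplus> q v) \<in> carrier (Spl R G)"
    if pq: "p \<in> carrier (Spl R G)" "q \<in> carrier (Spl R G)" for p q
  proof -
    have "(p u \<oplus> q u) \<ominus> (p v \<oplus> q v) \<in> label G e"
      if e: "e \<in> edges G" "ends G e = {u, v}" for e u v
    proof -
      note uv = wf_graph_ends[OF assms(1) e]
      have c: "p u \<in> carrier R" "p v \<in> carrier R" "q u \<in> carrier R" "q v \<in> carrier R"
        using pq uv by auto
      have "(p u \<oplus> q u) \<ominus> (p v \<oplus> q v) = (p u \<ominus> p v) \<oplus> (q u \<ominus> q v)"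
        using c by algebra
      moreover have "p u \<ominus> p v \<in> label G e" "q u \<ominus> q v \<in> label G e" using pq e by auto
      ultimately show ?thesis
        using assms(2) e by (simp add: additive_subgroup.a_closed ideal.axioms(1))
    qed
    thus ?thesis using pq wf_graph_ends[OF assms(1)] by (auto simp: PiE_iff)
  qed
  have 3: "(\<lambda>v\<in>verts G. a \<otimes> p v) \<in> carrier (Spl R G)"
    if pq: "a \<in> carrier R" "p \<in> carrier (Spl R G)" for a p
  proof -
    have "a \<otimes> p u \<ominus> a \<otimes> p v \<in> label G e"
      if e: "e \<in> edges G" "ends G e = {u, v}" for e u v
    proof -
      note uv = wf_graph_ends[OF assms(1) e]
      have c: "p u \<in> carrier R" "p v \<in> carrier R"
        using pq uv by auto
      have "a \<otimes> p u \<ominus> a \<otimes> p v = a \<otimes> (p u \<ominus> p v)"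
        using c pq(1) by algebra
      moreover have "p u \<ominus> p v \<in> label G e" using pq e by auto
      ultimately show ?thesis
        using assms(2) e pq(1) by (simp add: ideal.I_l_closed)
    qed
    thus ?thesis using pq wf_graph_ends[OF assms(1)] by (auto simp: PiE_iff)
  qed
  show ?thesis
    unfolding submodule_iff_closed[OF module_power_module]
  proof (intro conjI ballI)
    show "carrier (Spl R G) \<subseteq> carrier (power_module R (verts G))" by auto
  qed (use 1 2 3 in \<open>auto simp del: Spl_simps(1)\<close>)
qed

lemma (in cring) module_Spl:
  assumes "wf_graph G" and "\<forall>e\<in>edges G. ideal (label G e) R"
  shows "module R (Spl R G)"
  using submodule.submodule_is_module[OF submodule_Spl[OF assms] module_power_module]
  by (simp add: Spl_def)

lemma (in cring) fg_module_Spl: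
  assumes "noetherian_ring R" and "wf_graph G" and "\<forall>e\<in>edges G. ideal (label G e) R"
  shows "fg_module R (Spl R G)"
proof -
  note mod = module_Spl[OF assms(2,3)]
  have "finite (verts G)" using assms(2) by (simp add: wf_graph_def)
  from submodule_power_module_fg[OF is_cring assms(1) this _ submodule_Spl[OF assms(2,3)]]
  obtain X where X: "finite X" "X \<subseteq> carrier (Spl R G)"
    "\<And>N'. submodule N' R (power_module R (verts G)) \<Longrightarrow> X \<subseteq> N' \<Longrightarrow> carrier (Spl R G) \<subseteq> N'"
    by auto
  have "submodule N' R (power_module R (verts G))" if "submodule N' R (Spl R G)" for N'
    using that unfolding submodule_iff_closed[OF module_power_module] submodule_iff_closed[OF mod]
    by auto
  hence "carrier (Spl R G) \<subseteq> module_span R (Spl R G) X"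
    using X(3) unfolding module_span_def by blast
  moreover have "module_span R (Spl R G) X \<subseteq> carrier (Spl R G)"
    using X(2) module.carrier_is_submodule[OF mod] unfolding module_span_def by blast
  ultimately show ?thesis unfolding fg_module_def using mod X(1,2) by blast
qed

section \<open>Pullback of splines along contractions\<close>

lemma contraction_vertex:
  assumes "contraction G G' \<phi>" and "w \<in> verts G"
  obtains w' where "w' \<in> verts G'" and "\<phi> (Inl w) = Inl w'"
  using assms unfolding contraction_def by blast

text \<open>If an edge is collapsed, its ends have the same image and the difference is 0. If it is
  kept, its image joins the images of its ends and carries the same ideal, so the condition is the
  one at the image.\<close>

lemma (in cring) Spl_map_carrier:
  fixes G :: "('v, 'e, 'a set) lgraph" and G' :: "('w, 'f, 'a set) lgraph"
  assumes c: "contraction G G' \<phi>" and wf: "wf_graph G"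
    and id: "\<forall>e\<in>edges G. ideal (label G e) R"
    and p: "p \<in> carrier (Spl R G')"
  shows "Spl_map G G' \<phi> p \<in> carrier (Spl R G)"
proof -
  have carr: "p (projl (\<phi> (Inl w))) \<in> carrier R" if "w \<in> verts G" for w
    using contraction_vertex[OF c that] p by (metis (no_types, lifting) PiE_mem Spl_simps(1) mem_Collect_eq sum.sel(1))
  have "p (projl (\<phi> (Inl u))) \<ominus> p (projl (\<phi> (Inl v))) \<in> label G e"
    if e: "e \<in> edges G" "ends G e = {u, v}" for e u v
  proof -
    note uv = wf_graph_ends[OF wf e]
    obtain u' where u': "u' \<in> verts G'" "\<phi> (Inl u) = Inl u'" using contraction_vertex[OF c uv(1)] .
    obtain v' where v': "v' \<in> verts G'" "\<phi> (Inl v) = Inl v'" using contraction_vertex[OF c uv(2)] .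
    have b: "\<phi> ` bdry G (Inr e) = bdry G' (\<phi> (Inr e))" using c e unfolding contraction_def by blast
    have "\<phi> ` bdry G (Inr e) = {Inl u', Inl v'}" using e u' v' by simp
    note b = b[unfolded this]
    have "Inr e \<in> cells G" using e by (simp add: cells_def InrI)
    hence "\<phi> (Inr e) \<in> cells G'" using c unfolding contraction_def by blast
    then consider (v) x where "\<phi> (Inr e) = Inl x" | (e) f where "f \<in> edges G'" "\<phi> (Inr e) = Inr f"
      unfolding cells_def by blast
    thus ?thesis
    proof cases
      case v
      hence "u' = v'" using b by auto
      thus ?thesis using u' v' carr[OF uv(1)] id e
        by (simp add: minus_eq r_neg additive_subgroup.zero_closed ideal.axioms(1))
    next
      case (e f)
      have "(Inl :: 'w \<Rightarrow> 'w + 'f) ` {u', v'} = Inl ` ends G' f" using b e by simp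
      hence "ends G' f = {u', v'}" by (simp only: inj_image_eq_iff[OF inj_Inl])
      hence "p u' \<ominus> p v' \<in> label G' f" using p e by simp
      moreover have "label G' f = label G e" 
        using c that e unfolding contraction_def by blast
      ultimately show ?thesis using u' v' by simp
    qed
  qed
  thus ?thesis using carr wf_graph_ends[OF wf] by (auto simp: Spl_map_def)
qed

lemma (in cring) gop_module_Spl:
  assumes "noetherian_ring R" and "\<forall>I\<in>S. ideal I R"
  shows "gop_module R g S (Spl R) Spl_map"
  unfolding gop_module_def
proof (intro conjI ballI allI impI)
  note lgraph = labeled_graphs_def connected_graph_def
  have wf: "wf_graph G" "\<forall>e\<in>edges G. ideal (label G e) R" if "G \<in> labeled_graphs g S"
    for G :: "('v, 'e, 'a set) lgraph"
    using that assms(2) by (auto simp: lgraph)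
  show "fg_module R (Spl R G)" if "G \<in> labeled_graphs g S" for G :: "('v, 'e, 'a set) lgraph"
    using fg_module_Spl[OF assms(1) wf[OF that]] .
  show "Spl_map G G' \<phi> \<in> module_hom R (Spl R G') (Spl R G)"
    if G: "G \<in> labeled_graphs g S" and c: "contraction G G' \<phi>"
    for G G' :: "('v, 'e, 'a set) lgraph" and \<phi>
  proof -
    have "projl (\<phi> (Inl w)) \<in> verts G'" if "w \<in> verts G" for w
      using contraction_vertex[OF c that] by (metis sum.sel(1))
    thus ?thesis using Spl_map_carrier[OF c wf[OF G]]
      unfolding module_hom_def by (auto simp del: Spl_simps(1) simp: Spl_map_def)
  qed
  show "Spl_map G G (\<lambda>c\<in>cells G. c) x = x"
    if "G \<in> labeled_graphs g S" "x \<in> carrier (Spl R G)" for G :: "('v, 'e, 'a set) lgraph" and x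
    using that(2) by (auto simp: Spl_map_def cells_def PiE_iff extensional_def)
  show "Spl_map G G'' (compose (cells G) \<psi> \<phi>) x = Spl_map G G' \<phi> (Spl_map G' G'' \<psi> x)"
    if c: "contraction G G' \<phi>" for G G' G'' :: "('v, 'e, 'a set) lgraph" and \<phi> \<psi> x
  proof
    show "Spl_map G G'' (compose (cells G) \<psi> \<phi>) x w = Spl_map G G' \<phi> (Spl_map G' G'' \<psi> x) w" for w
    proof (cases "w \<in> verts G")
      case True
      then obtain w' where "w' \<in> verts G'" "\<phi> (Inl w) = Inl w'" using contraction_vertex[OF c] by blast
      thus ?thesis using True by (simp add: Spl_map_def compose_def cells_def InlI)
    qed (simp add: Spl_map_def)
  qed
qed

section \<open>Rooted spanning trees\<close>

text \<open>The tree is given by parent pointers instead of an edge set. The strictly decreasing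
  \<open>rank\<close> excludes cycles and provides the induction along paths to the root; fixing
  \<open>par r = r\<close> lets \<open>par\<close> be iterated without leaving the vertex
  set.\<close>

locale spanning_tree =
  fixes G :: "('v, 'e, 's) lgraph" and r :: 'v and par :: "'v \<Rightarrow> 'v" and pe :: "'v \<Rightarrow> 'e"
    and rank :: "'v \<Rightarrow> nat"
  assumes wf: "wf_graph G" and root: "r \<in> verts G" and par_root: "par r = r"
    and par_verts: "v \<in> verts G - {r} \<Longrightarrow> par v \<in> verts G"
    and pe_edges: "v \<in> verts G - {r} \<Longrightarrow> pe v \<in> edges G"
    and pe_ends: "v \<in> verts G - {r} \<Longrightarrow> ends G (pe v) = {v, par v}"
    and rank_par: "v \<in> verts G - {r} \<Longrightarrow> rank (par v) < rank v"

text \<open>This is the breadth-first tree: \<open>rank\<close> is the distance from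
  \<open>r\<close>, and the last edge of a shortest walk to \<open>v\<close> comes from a vertex
  closer to \<open>r\<close>.\<close>

lemma ex_spanning_tree:
  fixes G :: "('v, 'e, 's) lgraph"
  assumes "connected_graph G"
  obtains r par pe rank where "spanning_tree G r par pe rank"
proof -
  have wf: "wf_graph G" using assms by (simp add: connected_graph_def)
  obtain r where r: "r \<in> verts G" using assms by (auto simp: connected_graph_def)
  define rank where "rank v = (LEAST n. (r, v) \<in> adj G ^^ n)" for v
  have "\<exists>u e. u \<in> verts G \<and> e \<in> edges G \<and> ends G e = {v, u} \<and> rank u < rank v"
    if v: "v \<in> verts G - {r}" for v
  proof -
    have "(r, v) \<in> (adj G)\<^sup>*" using assms r v by (auto simp: connected_graph_def)
    then obtain n where "(r, v) \<in> adj G ^^ n" by (auto simp: rtrancl_power)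
    hence rv: "(r, v) \<in> adj G ^^ rank v" unfolding rank_def by (rule LeastI)
    with v obtain m where m: "rank v = Suc m" by (cases "rank v") auto
    then obtain u where u: "(r, u) \<in> adj G ^^ m" "(u, v) \<in> adj G" using rv by auto
    have "rank u \<le> m" unfolding rank_def by (rule Least_le) (rule u(1))
    moreover obtain e where "e \<in> edges G" "ends G e = {u, v}" using u(2) by (auto simp: adj_def)
    ultimately show ?thesis using m wf_graph_ends[OF wf]
      by (intro exI[of _ u] exI[of _ e]) (auto simp: insert_commute)
  qed
  then obtain par pe where *: "\<And>v. v \<in> verts G - {r} \<Longrightarrow>
    par v \<in> verts G \<and> pe v \<in> edges G \<and> ends G (pe v) = {v, par v} \<and> rank (par v) < rank v"
    by metis
  \<comment> \<open>The choice of parents says nothing about the root, so its value there is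
    overwritten.\<close>
  have "spanning_tree G r (par(r := r)) pe rank"
    by unfold_locales (use wf r * in auto)
  thus ?thesis by (rule that)
qed

context spanning_tree
begin

lemma par_neq: "v \<in> verts G - {r} \<Longrightarrow> par v \<noteq> v"
  using rank_par by fastforce

text \<open>Two different vertices sharing a parent edge would be each other's parents, which the
  rank forbids.\<close>

lemma pe_inj: "inj_on pe (verts G - {r})"
proof (rule inj_onI)
  fix v w assume v: "v \<in> verts G - {r}" and w: "w \<in> verts G - {r}" and eq: "pe v = pe w"
  have "{v, par v} = {w, par w}" using pe_ends[OF v] pe_ends[OF w] eq by simp
  thus "v = w" using rank_par[OF v] rank_par[OF w] by (auto simp: doubleton_eq_iff)
qed

lemma finite_verts: "finite (verts G)" and finite_edges: "finite (edges G)"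
  using wf by (auto simp: wf_graph_def)

text \<open>The tree has one edge for each vertex other than the root, so the genus counts the edges
  outside it. This makes the later bound independent of the size of \<open>G\<close>.\<close>

lemma card_nontree:
  assumes "genus G = int g"
  shows "card (edges G - pe ` (verts G - {r})) = g"
proof -
  have "card (pe ` (verts G - {r})) = card (verts G) - 1"
    using pe_inj root by (simp add: card_image)
  moreover have "card (verts G) \<ge> 1" using root finite_verts
    by (simp add: Suc_le_eq card_gt_0_iff) blast
  moreover have "pe ` (verts G - {r}) \<subseteq> edges G" using pe_edges by blast
  moreover from this have "card (pe ` (verts G - {r})) \<le> card (edges G)"
    using finite_edges by (rule card_mono[rotated])
  moreover have "card (edges G - pe ` (verts G - {r})) = card (edges G) - card (pe ` (verts G - {r}))"
    using calculation finite_edges by (meson card_Diff_subset finite_subset)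
  ultimately show ?thesis using assms by (simp add: genus_def)
qed

lemma par_closed: "v \<in> verts G \<Longrightarrow> par v \<in> verts G"
  using par_verts par_root by (cases "v = r") auto

lemma tree_induct [consumes 1, case_names root par]:
  assumes "v \<in> verts G" and "P r"
    and "\<And>v. v \<in> verts G - {r} \<Longrightarrow> P (par v) \<Longrightarrow> P v"
  shows "P v"
  using assms(1)
proof (induction "rank v" arbitrary: v rule: less_induct)
  case less
  thus ?case using assms(2,3) rank_par par_verts by (cases "v = r") auto
qed

text \<open>
  In a cycle made of tree edges, both cycle edges at the vertex furthest from the root would be the
  edge to its parent.
\<close>

lemma no_tree_cycle:
  assumes vs: "set vs \<subseteq> verts G" and es: "set es \<subseteq> pe ` (verts G - {r})" "es \<noteq> []"
    and len: "length vs = length es" and dist: "distinct es"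
    and inc: "\<And>i. i < length es \<Longrightarrow> ends G (es ! i) = {vs ! i, vs ! (Suc i mod length es)}"
  shows False
proof -
  define n where "n = length es"
  have n: "n > 0" using es by (simp add: n_def)
  define M where "M = Max (rank ` set vs)"
  have "M \<in> rank ` set vs" unfolding M_def using n len n_def by (intro Max_in) auto
  then obtain i where i: "i < n" "rank (vs ! i) = M"
    using len n_def by (auto simp: in_set_conv_nth)
  have top: "es ! k = pe (vs ! i) \<and> vs ! i \<in> verts G - {r}"
    if k: "k < n" "ends G (es ! k) = {vs ! i, y}" "y \<in> set vs" for k y
  proof -
    have "es ! k \<in> set es" using k n_def by simp
    then obtain w where w: "w \<in> verts G - {r}" "es ! k = pe w" using es by blast
    hence "{w, par w} = {vs ! i, y}" using pe_ends[OF w(1)] k by simp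
    moreover have "rank y \<le> rank (vs ! i)" using k(3) i by (simp add: M_def)
    ultimately have "w = vs ! i" using rank_par[OF w(1)] by (auto simp: doubleton_eq_iff)
    thus ?thesis using w by simp
  qed
  \<comment> \<open>The cyclic predecessor of \<open>i\<close>; adding \<open>n\<close> first avoids
    truncated subtraction at \<open>i = 0\<close>.\<close>
  define j where "j = (i + n - 1) mod n"
  have j: "j < n" "Suc j mod n = i"
    using n i by (simp_all add: j_def mod_Suc_eq)
  have memb: "vs ! k \<in> set vs" if "k < n" for k using that len n_def by simp
  have ti: "es ! i = pe (vs ! i)" "vs ! i \<in> verts G - {r}"
    using top[OF i(1) inc[folded n_def, OF i(1)] memb] n by auto
  have "ends G (es ! j) = {vs ! i, vs ! j}"
    using inc[folded n_def, OF j(1)] j(2) by (simp add: insert_commute)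
  from top[OF j(1) this memb[OF j(1)]] have "es ! j = es ! i" using ti by simp
  \<comment> \<open>Only a cycle of length one has an edge following itself. That edge would be a
    loop, and a vertex other than the root is never its own parent.\<close>
  hence "j = i" using dist i j n_def by (simp add: nth_eq_iff_index_eq)
  hence "ends G (es ! i) = {vs ! i}" using inc[folded n_def, OF i(1)] j(2) by simp
  thus False using ti pe_ends[OF ti(2)] par_neq[OF ti(2)] by auto
qed

text \<open>The relation is reflexive, so for \<open>v\<close> other than the root the vertices
  \<open>w\<close> of \<open>G\<close> with \<open>anc v w\<close> form the side of the tree edge
  \<open>pe v\<close> that is away from the root.\<close>

definition anc :: "'v \<Rightarrow> 'v \<Rightarrow> bool" where
  "anc v w \<longleftrightarrow> (\<exists>k. (par ^^ k) w = v)"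

text \<open>Its use is that passing from \<open>w\<close> to its parent can change the truth of
  \<open>anc v w\<close> only at \<open>w = v\<close>: the indicator function of the descendants of
  \<open>v\<close> has no jump except along \<open>pe v\<close>.\<close>

lemma anc_unfold: "anc v w \<longleftrightarrow> w = v \<or> anc v (par w)"
proof
  assume "anc v w"
  then obtain k where "(par ^^ k) w = v" by (auto simp: anc_def)
  thus "w = v \<or> anc v (par w)"
    by (cases k) (auto simp: anc_def funpow_swap1)
next
  assume "w = v \<or> anc v (par w)"
  thus "anc v w"
  proof
    assume "w = v" thus ?thesis unfolding anc_def by (intro exI[of _ 0]) simp
  next
    assume "anc v (par w)"
    then obtain k where "(par ^^ k) (par w) = v" by (auto simp: anc_def)
    hence "(par ^^ Suc k) w = v" by (simp add: funpow_swap1)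
    thus ?thesis unfolding anc_def by blast
  qed
qed

lemma rank_anc: "w \<in> verts G \<Longrightarrow> anc v w \<Longrightarrow> rank v \<le> rank w"
proof (induction w rule: tree_induct)
  case root
  have "(par ^^ k) r = r" for k by (induction k) (auto simp: par_root)
  thus ?case using root by (auto simp: anc_def)
next
  case (par w)
  thus ?case using anc_unfold[of v w] rank_par[of w] by auto
qed

lemma not_anc_par: "v \<in> verts G - {r} \<Longrightarrow> \<not> anc v (par v)"
  using rank_anc[of "par v" v] rank_par[of v] par_verts[of v] by auto

section \<open>Contracting part of a spanning tree\<close>

text \<open>Cutting the tree edges \<open>pe b\<close> with \<open>b\<close> in \<open>B\<close>
  splits the tree into components. The representative of \<open>v\<close> is the vertex of its
  component nearest to the root.\<close>

definition rep :: "'v set \<Rightarrow> 'v \<Rightarrow> 'v" where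
  "rep B v = (par ^^ (LEAST k. (par ^^ k) v \<in> insert r B)) v"

lemma rep_self: "v \<in> insert r B \<Longrightarrow> rep B v = v"
  by (simp add: rep_def Least_eq_0)

lemma rep_par:
  assumes "v \<in> verts G - insert r B"
  shows "rep B v = rep B (par v)"
proof -
  have "\<exists>k. (par ^^ k) v = r" if "v \<in> verts G" for v
    using that
  proof (induction v rule: tree_induct)
    case root
    show ?case by (intro exI[of _ 0]) simp
  next
    case (par v)
    then obtain k where "(par ^^ k) (par v) = r" by blast
    thus ?case by (intro exI[of _ "Suc k"]) (simp add: funpow_swap1)
  qed
  then obtain k where "(par ^^ k) v = r" using assms by blast
  hence k: "(par ^^ k) v \<in> insert r B" by simp
  have "(LEAST k. (par ^^ k) v \<in> insert r B) = Suc (LEAST k. (par ^^ Suc k) v \<in> insert r B)"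
    by (rule Least_Suc[where P = "\<lambda>k. (par ^^ k) v \<in> insert r B", OF k]) (use assms in simp)
  thus ?thesis by (simp add: rep_def funpow_swap1)
qed

lemma rep_in: "v \<in> verts G \<Longrightarrow> rep B v \<in> insert r B"
proof (induction v rule: tree_induct)
  case root
  show ?case by (simp add: rep_self)
next
  case (par v)
  thus ?case using rep_self[of v B] rep_par[of v B] by (cases "v \<in> insert r B") auto
qed

definition contracted :: "'v set \<Rightarrow> 'e set" where
  "contracted B = pe ` (verts G - insert r B)"

text \<open>Naming each collapsed component by its top vertex keeps the quotient in the types of
  \<open>G\<close>, so that it is again an object of the same category.\<close>

definition quot :: "'v set \<Rightarrow> ('v, 'e, 's) lgraph" where
  "quot B = \<lparr>verts = insert r B, edges = edges G - contracted B,
     ends = (\<lambda>e. rep B ` ends G e), label = label G\<rparr>"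

lemma quot_simps [simp]:
  "verts (quot B) = insert r B" "edges (quot B) = edges G - contracted B"
  "ends (quot B) e = rep B ` ends G e" "label (quot B) = label G"
  by (simp_all add: quot_def)

text \<open>The inverse of \<open>pe\<close> recovers the lower end of a contracted edge; the upper
  end has the same representative, so the image does not depend on this choice.\<close>

definition proj :: "'v set \<Rightarrow> 'v + 'e \<Rightarrow> 'v + 'e" where
  "proj B = (\<lambda>x\<in>cells G. case x of Inl v \<Rightarrow> Inl (rep B v)
     | Inr e \<Rightarrow> if e \<in> contracted B then Inl (rep B (the_inv_into (verts G - {r}) pe e)) else Inr e)"

lemma proj_vertex: "v \<in> verts G \<Longrightarrow> proj B (Inl v) = Inl (rep B v)"
  by (simp add: proj_def cells_def InlI)

lemma proj_kept: "e \<in> edges G - contracted B \<Longrightarrow> proj B (Inr e) = Inr e"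
  by (simp add: proj_def cells_def InrI)

lemma proj_contracted: "v \<in> verts G - insert r B \<Longrightarrow> proj B (Inr (pe v)) = Inl (rep B v)"
  using pe_edges[of v] the_inv_into_f_f[OF pe_inj, of v]
  by (auto simp: proj_def cells_def contracted_def)

lemma wf_quot:
  assumes B: "B \<subseteq> verts G - {r}"
  shows "wf_graph (quot B)"
  unfolding wf_graph_def
proof (intro conjI ballI)
  show "finite (verts (quot B))" "finite (edges (quot B))"
    using finite_verts finite_edges finite_subset[OF B] by auto
  fix e assume "e \<in> edges (quot B)"
  then obtain u v where "u \<in> verts G" "v \<in> verts G" "ends G e = {u, v}"
    using wf by (auto simp: wf_graph_def)
  thus "\<exists>u\<in>verts (quot B). \<exists>v\<in>verts (quot B). ends (quot B) e = {u, v}"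
    using rep_in[of u B] rep_in[of v B] by (intro bexI[of _ "rep B u"] bexI[of _ "rep B v"]) auto
qed

lemma rep_contracted:
  assumes "e \<in> contracted B" "ends G e = {u, v}"
  shows "rep B u = rep B v"
proof -
  obtain w where w: "w \<in> verts G - insert r B" "e = pe w" using assms(1) by (auto simp: contracted_def)
  hence "{w, par w} = {u, v}" using pe_ends[of w] assms(2) by auto
  thus ?thesis using rep_par[OF w(1)] by (auto simp: doubleton_eq_iff)
qed

lemma connected_quot:
  assumes B: "B \<subseteq> verts G - {r}" and "connected_graph G"
  shows "connected_graph (quot B)"
  unfolding connected_graph_def
proof (intro conjI ballI)
  show "wf_graph (quot B)" by (rule wf_quot[OF B])
  have *: "(rep B u, rep B v) \<in> (adj (quot B))\<^sup>*" if "(u, v) \<in> (adj G)\<^sup>*" for u v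
    using that
  proof (induction rule: rtrancl_induct)
    case (step x y)
    then obtain e where e: "e \<in> edges G" "ends G e = {x, y}" by (auto simp: adj_def)
    show ?case
    proof (cases "e \<in> contracted B")
      case True
      thus ?thesis using rep_contracted e step by metis
    next
      case False
      hence "(rep B x, rep B y) \<in> adj (quot B)" using e by (auto simp: adj_def)
      thus ?thesis using step by simp
    qed
  qed simp
  fix u v assume uv: "u \<in> verts (quot B)" "v \<in> verts (quot B)"
  hence "(u, v) \<in> (adj G)\<^sup>*" using assms(2) B root by (auto simp: connected_graph_def)
  from *[OF this] show "(u, v) \<in> (adj (quot B))\<^sup>*" using uv rep_self by simp
qed simp

text \<open>Each contracted tree edge disappears together with exactly one vertex, its lower
  end.\<close>

lemma genus_quot:
  assumes B: "B \<subseteq> verts G - {r}"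
  shows "genus (quot B) = genus G"
proof -
  have sub: "contracted B \<subseteq> edges G" using pe_edges by (auto simp: contracted_def)
  have "card (contracted B) = card (verts G - insert r B)"
    unfolding contracted_def by (rule card_image) (rule inj_on_subset[OF pe_inj], blast)
  moreover have "card (edges G) = card (edges G - contracted B) + card (contracted B)"
    using sub finite_edges by (metis add.commute card_Diff_subset card_mono finite_subset le_add_diff_inverse)
  moreover have "insert r B \<subseteq> verts G" using B root by blast
  hence "card (verts G) = card (verts G - insert r B) + card (insert r B)"
    using finite_verts by (metis add.commute card_Diff_subset card_mono finite_subset le_add_diff_inverse)
  ultimately show ?thesis by (simp add: genus_def)
qed

lemma quot_labeled_graph:
  assumes "B \<subseteq> verts G - {r}" and "G \<in> labeled_graphs g S"
  shows "quot B \<in> labeled_graphs g S"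
  using assms connected_quot genus_quot by (auto simp: labeled_graphs_def)

text \<open>The fibre is one component of the cut tree. It is connected because climbing to the
  parent stays inside until \<open>w\<close> is reached, and it has no cycle because all its edges
  are tree edges.\<close>

lemma subtree_fibre:
  assumes B: "B \<subseteq> verts G - {r}" and w: "w \<in> insert r B"
  shows "subtree G {x \<in> cells G. proj B x = Inl w}"
proof -
  let ?A = "{x \<in> cells G. proj B x = Inl w}"
  let ?H = "G\<lparr>verts := {v. Inl v \<in> ?A}, edges := {e. Inr e \<in> ?A}\<rparr>"
  have V: "verts ?H = {v \<in> verts G. rep B v = w}"
    by (auto simp: cells_def proj_vertex)
  have E: "edges ?H = pe ` {v \<in> verts G - insert r B. rep B v = w}" (is "_ = ?R")
  proof
    show "edges ?H \<subseteq> ?R"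
    proof
      fix e assume "e \<in> edges ?H"
      hence e: "e \<in> edges G" "proj B (Inr e) = Inl w" by (auto simp: cells_def)
      hence "e \<in> contracted B" using proj_kept[of e B] by auto
      then obtain v where "v \<in> verts G - insert r B" "e = pe v" by (auto simp: contracted_def)
      thus "e \<in> ?R" using e proj_contracted[of v B] by auto
    qed
    show "?R \<subseteq> edges ?H"
      using proj_contracted pe_edges by (auto simp: cells_def)
  qed
  have ends: "ends ?H = ends G" by simp
  have wfH: "wf_graph ?H"
    unfolding wf_graph_def V E ends
  proof (intro conjI ballI)
    fix e assume "e \<in> ?R"
    then obtain v where v: "v \<in> verts G - insert r B" "rep B v = w" "e = pe v" by blast
    hence "par v \<in> verts G" "rep B (par v) = w" "ends G e = {v, par v}"
      using pe_ends[of v] rep_par[of v B] par_verts[of v] by auto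
    thus "\<exists>u\<in>{v \<in> verts G. rep B v = w}. \<exists>v\<in>{v \<in> verts G. rep B v = w}. ends G e = {u, v}"
      using v by blast
  qed (use finite_verts in auto)
  have to_w: "v \<in> verts ?H \<Longrightarrow> (v, w) \<in> (adj ?H)\<^sup>*" if "v \<in> verts G" for v
    using that
  proof (induction v rule: tree_induct)
    case root
    thus ?case unfolding V using rep_self[of r B] by auto
  next
    case (par v)
    show ?case
    proof (cases "v \<in> insert r B")
      case True
      thus ?thesis using par.prems rep_self[of v B] unfolding V by auto
    next
      case False
      hence v: "v \<in> verts G - insert r B" using par by blast
      hence "rep B (par v) = w" using par.prems rep_par[OF v] unfolding V by simp
      hence 1: "(par v, w) \<in> (adj ?H)\<^sup>*" using par.IH par_closed v unfolding V by blast
      have "pe v \<in> edges ?H" unfolding E using v par.prems unfolding V by blast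
      hence "(v, par v) \<in> adj ?H" unfolding adj_def ends using pe_ends[of v] v by blast
      thus ?thesis using 1 by (rule converse_rtrancl_into_rtrancl)
    qed
  qed
  have "sym (adj ?H)" by (auto simp: adj_def sym_def insert_commute)
  hence "sym ((adj ?H)\<^sup>*)" by (rule sym_rtrancl)
  hence "(u, v) \<in> (adj ?H)\<^sup>*" if "u \<in> verts ?H" "v \<in> verts ?H" for u v
    using to_w[of u] to_w[of v] that V by (metis (no_types, lifting) mem_Collect_eq rtrancl_trans symE)
  moreover have "w \<in> verts ?H" using w B root rep_self[OF w] unfolding V by blast
  ultimately have "connected_graph ?H" using wfH unfolding connected_graph_def by blast
  moreover have "\<not> cycle ?H vs es" for vs es
  proof
    assume c: "cycle ?H vs es"
    show False
    proof (rule no_tree_cycle)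
      show "set vs \<subseteq> verts G" using c unfolding cycle_def V by blast
      show "set es \<subseteq> pe ` (verts G - {r})" using c unfolding cycle_def E by blast
      show "ends G (es ! i) = {vs ! i, vs ! (Suc i mod length es)}" if "i < length es" for i
        using c that unfolding cycle_def ends by blast
    qed (use c in \<open>auto simp: cycle_def\<close>)
  qed
  ultimately show ?thesis unfolding subtree_def tree_def by blast
qed

lemma contraction_proj:
  assumes B: "B \<subseteq> verts G - {r}"
  shows "contraction G (quot B) (proj B)"
  unfolding contraction_def
proof (intro conjI ballI impI)
  have contr: "\<exists>v. v \<in> verts G - insert r B \<and> e = pe v" if "e \<in> contracted B" for e
    using that by (auto simp: contracted_def)
  have Inl: "proj B (Inl v) = Inl (rep B v) \<and> rep B v \<in> insert r B" if "v \<in> verts G" for v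
    using proj_vertex rep_in that by blast
  show "proj B \<in> cells G \<rightarrow>\<^sub>E cells (quot B)"
  proof
    fix x assume "x \<in> cells G"
    then consider v where "v \<in> verts G" "x = Inl v"
      | e where "e \<in> edges G - contracted B" "x = Inr e"
      | v where "v \<in> verts G - insert r B" "x = Inr (pe v)"
      unfolding cells_def using contr by blast
    thus "proj B x \<in> cells (quot B)"
      by cases (use Inl proj_kept proj_contracted[of _ B] rep_in[of _ B] in \<open>auto simp: cells_def\<close>)
  qed (simp add: proj_def)
  show "proj B ` (Inl ` verts G) = Inl ` verts (quot B)"
  proof
    have "proj B (Inl v) \<in> Inl ` verts (quot B)" if "v \<in> verts G" for v
      using Inl[OF that] by (metis imageI quot_simps(1))
    thus "proj B ` (Inl ` verts G) \<subseteq> Inl ` verts (quot B)" by blast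
    show "Inl ` verts (quot B) \<subseteq> proj B ` (Inl ` verts G)"
    proof
      fix x :: "'v + 'e" assume "x \<in> Inl ` verts (quot B)"
      then obtain v where v: "x = Inl v" "v \<in> insert r B" by auto
      hence "proj B (Inl v) = x" "v \<in> verts G" using Inl[of v] rep_self[of v B] B root by auto
      thus "x \<in> proj B ` (Inl ` verts G)" by blast
    qed
  qed
  show "proj B ` bdry G (Inr e) = bdry (quot B) (proj B (Inr e))" if e: "e \<in> edges G" for e
  proof -
    obtain u v where uv: "u \<in> verts G" "v \<in> verts G" "ends G e = {u, v}"
      using wf e by (auto simp: wf_graph_def)
    show ?thesis
    proof (cases "e \<in> contracted B")
      case True
      then obtain w where w: "w \<in> verts G - insert r B" "e = pe w" using contr by blast
      hence "w \<in> {u, v}" using uv pe_ends[of w] by auto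
      thus ?thesis using w proj_contracted[OF w(1)] uv rep_contracted[OF True uv(3)]
        by (auto simp: Inl)
    next
      case False
      thus ?thesis using e uv by (simp add: proj_kept Inl)
    qed
  qed
  show "bij_betw (proj B) {x \<in> cells G. proj B x \<in> Inr ` edges (quot B)} (Inr ` edges (quot B))"
  proof -
    \<comment> \<open>The cells sent to edges are exactly the kept edges, and \<open>proj B\<close>
      fixes them, so the required bijection is an identity map.\<close>
    have "{x \<in> cells G. proj B x \<in> Inr ` edges (quot B)} = Inr ` edges (quot B)" (is "?L = ?R")
    proof
      show "?L \<subseteq> ?R"
      proof
        fix x assume x: "x \<in> ?L"
        then consider v where "v \<in> verts G" "x = Inl v"
          | e where "e \<in> edges G - contracted B" "x = Inr e"
          | v where "v \<in> verts G - insert r B" "x = Inr (pe v)"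
          unfolding cells_def using contr by blast
        thus "x \<in> ?R" by cases (use x Inl proj_contracted in auto)
      qed
    qed (auto simp: cells_def proj_kept)
    moreover have "proj B ` Inr ` edges (quot B) = Inr ` edges (quot B)"
      by (simp add: image_image proj_kept cong: image_cong_simp)
    ultimately show ?thesis by (auto simp: bij_betw_def inj_on_def proj_kept)
  qed
  show "label (quot B) e' = label G e" if "e \<in> edges G" "e' \<in> edges (quot B)" "proj B (Inr e) = Inr e'"
    for e e'
    using that contr[of e] proj_contracted proj_kept[of e B] by (cases "e \<in> contracted B") auto
  show "subtree G {x \<in> cells G. proj B x = Inl v}" if "v \<in> verts (quot B)" for v
    using subtree_fibre[OF B] that by simp
qed

end

section \<open>Finitely many isomorphism classes\<close>

definition graph_iso ::
  "('v, 'e, 's) lgraph \<Rightarrow> ('w, 'f, 's) lgraph \<Rightarrow> ('v \<Rightarrow> 'w) \<Rightarrow> ('e \<Rightarrow> 'f) \<Rightarrow> bool" where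
  "graph_iso G H a b \<longleftrightarrow> bij_betw a (verts G) (verts H) \<and> bij_betw b (edges G) (edges H) \<and>
     (\<forall>e\<in>edges G. ends H (b e) = a ` ends G e \<and> label H (b e) = label G e)"

lemma wf_graph_ends_subset: "wf_graph G \<Longrightarrow> e \<in> edges G \<Longrightarrow> ends G e \<subseteq> verts G"
  unfolding wf_graph_def by fastforce

text \<open>Representatives are compared through models on natural numbers: two graphs with the same
  model are isomorphic to each other.\<close>

lemma graph_iso_common_target:
  assumes "wf_graph H" and G: "graph_iso G K a b" and H: "graph_iso H K c d"
  shows "graph_iso G H (inv_into (verts H) c \<circ> a) (inv_into (edges H) d \<circ> b)"
  unfolding graph_iso_def
proof (intro conjI ballI)
  have c: "inj_on c (verts H)" using H by (auto simp: graph_iso_def bij_betw_def)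
  have "bij_betw a (verts G) (verts K)" "bij_betw (inv_into (verts H) c) (verts K) (verts H)"
    "bij_betw b (edges G) (edges K)" "bij_betw (inv_into (edges H) d) (edges K) (edges H)"
    using G H by (auto simp: graph_iso_def bij_betw_inv_into)
  thus "bij_betw (inv_into (verts H) c \<circ> a) (verts G) (verts H)"
    "bij_betw (inv_into (edges H) d \<circ> b) (edges G) (edges H)"
    by (auto intro: bij_betw_trans)
  fix e assume e: "e \<in> edges G"
  define f where "f = inv_into (edges H) d (b e)"
  have "b e \<in> edges K" using G e by (auto simp: graph_iso_def bij_betw_def)
  hence "b e \<in> d ` edges H" using H by (auto simp: graph_iso_def bij_betw_def)
  hence f: "f \<in> edges H" "d f = b e" unfolding f_def by (auto intro: inv_into_into f_inv_into_f)
  have "c ` ends H f = ends K (d f) \<and> label H f = label K (d f)"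
    using H f(1) by (simp add: graph_iso_def)
  hence eq: "c ` ends H f = a ` ends G e" "label H f = label G e"
    using G e f(2) by (auto simp: graph_iso_def)
  have "inv_into (verts H) c ` c ` ends H f = ends H f"
    using wf_graph_ends_subset[OF assms(1) f(1)] by (rule inv_into_image_cancel[OF c])
  hence "ends H f = inv_into (verts H) c ` a ` ends G e" using eq by simp
  thus "ends H ((inv_into (edges H) d \<circ> b) e) = (inv_into (verts H) c \<circ> a) ` ends G e"
    "label H ((inv_into (edges H) d \<circ> b) e) = label G e"
    using eq(2) by (simp_all add: f_def image_image)
qed

text \<open>There are finitely many models on initial segments of the natural numbers. The types
  \<open>'v\<close> and \<open>'e\<close> are arbitrary and need not contain these models, so for
  each model that is realised an actual object is chosen.\<close>

lemma finite_isomorphism_classes: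
  fixes S :: "'s set"
  assumes "finite S"
  obtains \<G> :: "('v, 'e, 's) lgraph set" where "finite \<G>" and "\<G> \<subseteq> labeled_graphs g S"
    and "\<And>G :: ('v, 'e, 's) lgraph. G \<in> labeled_graphs g S \<Longrightarrow> card (verts G) \<le> N \<Longrightarrow> \<exists>H\<in>\<G>. \<exists>a b. graph_iso G H a b"
proof -
  define std :: "nat \<times> nat \<times> (nat \<Rightarrow> nat set) \<times> (nat \<Rightarrow> 's) \<Rightarrow> (nat, nat, 's) lgraph"
    where "std = (\<lambda>(n, m, f, l). \<lparr>verts = {0..<n}, edges = {0..<m}, ends = f, label = l\<rparr>)"
  \<comment> \<open>The genus formula gives \<open>m = n + g - 1\<close>, hence the bound on the
    edges. Extensional functions make the choices of ends and labels finite in number; models that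
    are not well-formed are discarded later by \<open>P\<close>.\<close>
  define C where "C = std ` (SIGMA n:{..N}. SIGMA m:{..N + g}.
    ({0..<m} \<rightarrow>\<^sub>E Pow {0..<n}) \<times> ({0..<m} \<rightarrow>\<^sub>E S))"
  define P where "P K G \<longleftrightarrow> G \<in> labeled_graphs g S \<and> (\<exists>a b. graph_iso G K a b)"
    for K :: "(nat, nat, 's) lgraph" and G :: "('v, 'e, 's) lgraph"
  define \<G> where "\<G> = (\<lambda>K. SOME G. P K G) ` {K \<in> C. \<exists>G. P K G}"
  have "finite C" unfolding C_def using assms
    by (intro finite_imageI finite_SigmaI finite_cartesian_product finite_PiE) auto
  hence "finite \<G>" by (simp add: \<G>_def)
  moreover have "\<G> \<subseteq> labeled_graphs g S"
  proof
    fix G assume "G \<in> \<G>"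
    then obtain K where K: "\<exists>G. P K G" and "G = (SOME G. P K G)" unfolding \<G>_def by blast
    moreover from K have "P K (SOME G. P K G)" by (rule someI_ex)
    ultimately have "P K G" by simp
    thus "G \<in> labeled_graphs g S" by (simp add: P_def)
  qed
  moreover have "\<exists>H\<in>\<G>. \<exists>a b. graph_iso G H a b"
    if G: "G \<in> labeled_graphs g S" and card: "card (verts G) \<le> N" for G :: "('v, 'e, 's) lgraph"
  proof -
    have wf: "wf_graph G" and lab: "label G \<in> edges G \<rightarrow> S" and gen: "genus G = int g"
      using G by (auto simp: labeled_graphs_def connected_graph_def)
    define n where "n = card (verts G)"
    define m where "m = card (edges G)"
    have "finite (verts G)" "finite (edges G)" using wf by (auto simp: wf_graph_def)
    then obtain a b where a: "bij_betw a (verts G) {0..<n}" and b: "bij_betw b (edges G) {0..<m}"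
      unfolding n_def m_def using ex_bij_betw_finite_nat by metis
    define b' where "b' = inv_into (edges G) b"
    have b': "b' i \<in> edges G" if "i < m" for i
      using b that inv_into_into[of i b "edges G"] unfolding b'_def bij_betw_def by simp
    have b'b: "b' (b e) = e" if "e \<in> edges G" for e
      using b that unfolding b'_def bij_betw_def by simp
    define f where "f = (\<lambda>i\<in>{0..<m}. a ` ends G (b' i))"
    define l where "l = (\<lambda>i\<in>{0..<m}. label G (b' i))"
    let ?K = "std (n, m, f, l)"
    have "a ` ends G (b' i) \<subseteq> {0..<n}" if "i < m" for i
      using image_mono[OF wf_graph_ends_subset[OF wf b'[OF that]], of a] a by (simp add: bij_betw_def)
    hence "f \<in> {0..<m} \<rightarrow>\<^sub>E Pow {0..<n}" unfolding f_def by auto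
    moreover have "l \<in> {0..<m} \<rightarrow>\<^sub>E S"
      unfolding l_def using b' lab by auto
    moreover have "n \<le> N" "m \<le> N + g" using card gen by (auto simp: n_def m_def genus_def)
    ultimately have "?K \<in> C" unfolding C_def by auto
    moreover have iso: "graph_iso G ?K a b"
      using a b b'b bij_betwE[OF b] by (auto simp: graph_iso_def std_def f_def l_def)
    hence "P ?K G" using G unfolding P_def by (intro conjI exI)
    hence ex: "\<exists>G. P ?K G" by (rule exI)
    ultimately have K: "?K \<in> {K \<in> C. \<exists>G. P K G}" by (intro CollectI conjI)
    define H where "H = (SOME G. P ?K G)"
    have "P ?K H" unfolding H_def using ex by (rule someI_ex)
    then obtain c d where H: "H \<in> labeled_graphs g S" "graph_iso H ?K c d"
      unfolding P_def by (elim conjE exE)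
    have "wf_graph H" using H(1) by (auto simp: labeled_graphs_def connected_graph_def)
    hence "\<exists>a b. graph_iso G H a b" by (intro exI) (rule graph_iso_common_target[OF _ iso H(2)])
    moreover have "H \<in> \<G>" using K unfolding \<G>_def H_def by (rule imageI)
    ultimately show ?thesis by (rule bexI)
  qed
  ultimately show ?thesis by (rule that)
qed

text \<open>This transfers a contraction onto a quotient to the chosen representative of that
  quotient. Restricting the composite to \<open>cells G\<close> keeps it extensional.\<close>

lemma contraction_graph_iso:
  assumes wf: "wf_graph G" and c: "contraction G Q \<phi>" and i: "graph_iso Q H a b"
  shows "contraction G H (\<lambda>x\<in>cells G. map_sum a b (\<phi> x))"
  unfolding contraction_def
proof (intro conjI ballI impI)
  let ?\<psi> = "\<lambda>x\<in>cells G. map_sum a b (\<phi> x)"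
  have Inl_cells: "Inl v \<in> cells G \<longleftrightarrow> v \<in> verts G" and Inr_cells: "Inr e \<in> cells G \<longleftrightarrow> e \<in> edges G" for v e
    by (auto simp: cells_def)
  have a: "bij_betw a (verts Q) (verts H)" and b: "bij_betw b (edges Q) (edges H)"
    and ends: "\<And>e. e \<in> edges Q \<Longrightarrow> ends H (b e) = a ` ends Q e"
    and lab: "\<And>e. e \<in> edges Q \<Longrightarrow> label H (b e) = label Q e"
    using i by (auto simp: graph_iso_def)
  have in_cells: "\<phi> x \<in> cells Q" if "x \<in> cells G" for x
    using c that unfolding contraction_def by blast
  have "map_sum a b ` cells Q = a ` verts Q <+> b ` edges Q"
    unfolding cells_def Plus_def by (simp add: image_Un image_image)
  hence map_cells: "map_sum a b ` cells Q = cells H"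
    using a b by (simp add: cells_def bij_betw_def)
  have inj: "inj_on (map_sum a b) (cells Q)"
    using bij_betw_imp_inj_on[OF a] bij_betw_imp_inj_on[OF b]
    by (intro inj_onI) (auto simp: cells_def dest: inj_onD)
  show "?\<psi> \<in> cells G \<rightarrow>\<^sub>E cells H"
    using in_cells map_cells by auto
  show "?\<psi> ` (Inl ` verts G) = Inl ` verts H"
  proof -
    have "?\<psi> ` (Inl ` verts G) = map_sum a b ` (\<phi> ` (Inl ` verts G))"
      by (auto simp: Inl_cells image_iff)
    also have "\<dots> = map_sum a b ` (Inl ` verts Q)" using c unfolding contraction_def by simp
    also have "\<dots> = Inl ` (a ` verts Q)" by (simp add: image_image)
    also have "\<dots> = Inl ` verts H" using a by (simp add: bij_betw_def)
    finally show ?thesis .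
  qed
  show "?\<psi> ` bdry G (Inr e) = bdry H (?\<psi> (Inr e))" if e: "e \<in> edges G" for e
  proof -
    have "bdry G (Inr e) \<subseteq> cells G"
      using wf_graph_ends_subset[OF wf e] by (auto simp: cells_def)
    hence "?\<psi> ` bdry G (Inr e) = map_sum a b ` (\<phi> ` bdry G (Inr e))"
      by (auto simp: image_iff subset_iff)
    also have "\<dots> = map_sum a b ` bdry Q (\<phi> (Inr e))" using c e unfolding contraction_def by simp
    also have "\<dots> = bdry H (map_sum a b (\<phi> (Inr e)))"
    proof (cases "\<phi> (Inr e)")
      case (Inr f)
      hence "f \<in> edges Q" using in_cells[of "Inr e"] e by (auto simp: cells_def)
      thus ?thesis using Inr ends by (simp add: image_image)
    qed simp
    finally show ?thesis using e by (simp add: Inr_cells)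
  qed
  show "bij_betw ?\<psi> {x \<in> cells G. ?\<psi> x \<in> Inr ` edges H} (Inr ` edges H)"
  proof -
    have Inr_iff: "map_sum a b y \<in> Inr ` edges H \<longleftrightarrow> y \<in> Inr ` edges Q" if "y \<in> cells Q" for y
      using that bij_betwE[OF b] by (auto simp: cells_def)
    have "bij_betw (map_sum a b) (Inr ` edges Q) (Inr ` edges H)"
      unfolding bij_betw_def
    proof
      show "inj_on (map_sum a b) (Inr ` edges Q)"
        by (rule inj_on_subset[OF inj]) (auto simp: cells_def)
      have "map_sum a b ` Inr ` edges Q = Inr ` (b ` edges Q)" by (simp add: image_image)
      thus "map_sum a b ` Inr ` edges Q = Inr ` edges H" using b by (simp add: bij_betw_def)
    qed
    moreover have "bij_betw \<phi> {x \<in> cells G. \<phi> x \<in> Inr ` edges Q} (Inr ` edges Q)"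
      using c unfolding contraction_def by blast
    ultimately have "bij_betw (map_sum a b \<circ> \<phi>) {x \<in> cells G. \<phi> x \<in> Inr ` edges Q} (Inr ` edges H)"
      by (rule bij_betw_trans[rotated])
    moreover have "{x \<in> cells G. ?\<psi> x \<in> Inr ` edges H} = {x \<in> cells G. \<phi> x \<in> Inr ` edges Q}"
      using Inr_iff in_cells by auto
    moreover have "bij_betw ?\<psi> {x \<in> cells G. \<phi> x \<in> Inr ` edges Q} (Inr ` edges H)
        \<longleftrightarrow> bij_betw (map_sum a b \<circ> \<phi>) {x \<in> cells G. \<phi> x \<in> Inr ` edges Q} (Inr ` edges H)"
      by (rule bij_betw_cong) simp
    ultimately show ?thesis by (simp only:)
  qed
  show "label H e' = label G e" if e: "e \<in> edges G" "e' \<in> edges H" "?\<psi> (Inr e) = Inr e'" for e e'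
  proof -
    have *: "map_sum a b (\<phi> (Inr e)) = Inr e'" using e by (simp add: Inr_cells)
    then obtain f where f: "\<phi> (Inr e) = Inr f" "e' = b f" by (cases "\<phi> (Inr e)") auto
    hence "f \<in> edges Q" using in_cells[of "Inr e"] e by (auto simp: cells_def)
    moreover have "label Q f = label G e" 
      using c e(1) f(1) calculation unfolding contraction_def by blast
    ultimately show ?thesis using lab f(2) by simp
  qed
  show "subtree G {x \<in> cells G. ?\<psi> x = Inl v}" if "v \<in> verts H" for v
  proof -
    have "v \<in> a ` verts Q" using that a by (simp add: bij_betw_def)
    then obtain w where w: "w \<in> verts Q" "v = a w" by blast
    have "map_sum a b y = Inl v \<longleftrightarrow> y = Inl w" if "y \<in> cells Q" for y
      using that w inj_on_eq_iff[OF bij_betw_imp_inj_on[OF a]] by (auto simp: cells_def)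
    hence "{x \<in> cells G. ?\<psi> x = Inl v} = {x \<in> cells G. \<phi> x = Inl w}"
      using in_cells by auto
    thus ?thesis using c w unfolding contraction_def by simp
  qed
qed

section \<open>Splines supported on few tree edges\<close>

text \<open>A jump is recorded by the lower end of its tree edge, so this set can serve directly as
  the set \<open>B\<close> of a quotient.\<close>

definition (in spanning_tree) jumps :: "('v \<Rightarrow> 'c) \<Rightarrow> 'v set" where
  "jumps p = {v \<in> verts G - {r}. p v \<noteq> p (par v)}"

text \<open>The climb from a vertex to its representative crosses only tree edges without a
  jump.\<close>

lemma (in spanning_tree) rep_jumps:
  "v \<in> verts G \<Longrightarrow> p (rep (jumps p) v) = p v"
proof (induction v rule: tree_induct)
  case root
  show ?case by (simp add: rep_self)
next
  case (par v)
  show ?case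
  proof (cases "v \<in> jumps p")
    case True
    thus ?thesis by (simp add: rep_self)
  next
    case False
    hence "p v = p (par v)" using par by (simp add: jumps_def)
    moreover have "rep (jumps p) v = rep (jumps p) (par v)"
      using False par by (intro rep_par) auto
    ultimately show ?thesis using par by simp
  qed
qed

text \<open>Being constant on the fibres of \<open>proj\<close>, the spline \<open>p\<close>
  descends to the quotient by its values at the representatives, and the isomorphism carries it on
  to \<open>H\<close>. Every edge of the quotient is an edge of \<open>G\<close> whose ends have the
  same values, so the spline conditions are inherited.\<close>

lemma Spl_pullback_of_bounded:
  fixes R :: "('a, 'b) ring_scheme" and G H :: "('v, 'e, 'a set) lgraph"
  assumes tree: "spanning_tree G r par pe rank" and p: "p \<in> carrier (Spl R G)"
    and H: "graph_iso (spanning_tree.quot G r par pe (spanning_tree.jumps G r par p)) H a b"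
  shows "\<exists>\<psi>. contraction G H \<psi> \<and> p \<in> Spl_map G H \<psi> ` carrier (Spl R H)"
proof -
  interpret spanning_tree G r par pe rank by fact
  define B where "B = jumps p"
  have B: "B \<subseteq> verts G - {r}" by (auto simp: B_def jumps_def)
  note H = H[folded B_def]
  have rep: "p (rep B v) = p v" if "v \<in> verts G" for v unfolding B_def by (rule rep_jumps[OF that])
  let ?Q = "quot B"
  let ?\<psi> = "\<lambda>x\<in>cells G. map_sum a b (proj B x)"
  have contr: "contraction G H ?\<psi>"
    by (rule contraction_graph_iso[OF wf contraction_proj[OF B] H])
  have a: "bij_betw a (insert r B) (verts H)" and b: "bij_betw b (edges ?Q) (edges H)"
    and iso: "\<And>e. e \<in> edges ?Q \<Longrightarrow> ends H (b e) = a ` ends ?Q e \<and> label H (b e) = label ?Q e"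
    using H unfolding graph_iso_def quot_simps(1) by blast+
  define c where "c = inv_into (insert r B) a"
  have ca: "c (a v) = v" if "v \<in> insert r B" for v
    using a that unfolding c_def bij_betw_def by (simp add: inv_into_f_f)
  have c: "c v \<in> insert r B" if "v \<in> verts H" for v
  proof -
    have "v \<in> a ` insert r B" using that bij_betw_imp_surj_on[OF a] by (simp only:)
    then obtain x where "x \<in> insert r B" "v = a x" by blast
    thus ?thesis using ca by simp
  qed
  define q where "q = (\<lambda>v\<in>verts H. p (c v))"
  have q_rep: "a (rep B z) \<in> verts H" "q (a (rep B z)) = p z" if "z \<in> verts G" for z
  proof -
    show "a (rep B z) \<in> verts H" using a rep_in[OF that] by (rule bij_betw_apply)
    thus "q (a (rep B z)) = p z" using ca[OF rep_in[OF that]] rep[OF that] by (simp add: q_def)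
  qed
  have "q u \<ominus>\<^bsub>R\<^esub> q v \<in> label H f" if f: "f \<in> edges H" "ends H f = {u, v}" for f u v
  proof -
    have "f \<in> b ` edges ?Q" using f(1) bij_betw_imp_surj_on[OF b] by (simp only:)
    then obtain e where e: "e \<in> edges ?Q" "f = b e" by blast
    have eG: "e \<in> edges G" using e by simp
    then obtain x y where xy: "x \<in> verts G" "y \<in> verts G" "ends G e = {x, y}"
      using wf by (auto simp: wf_graph_def)
    have "ends H f = a ` rep B ` {x, y}"
      unfolding e(2) xy(3)[symmetric] using iso[OF e(1)] unfolding quot_simps by (rule conjunct1)
    hence "{u, v} = {a (rep B x), a (rep B y)}" unfolding f(2) by simp
    \<comment> \<open>Ends are unordered, so both matchings occur. Each is covered because the
      spline condition quantifies over both ways of naming the ends.\<close>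
    hence "u = a (rep B x) \<and> v = a (rep B y) \<or> u = a (rep B y) \<and> v = a (rep B x)"
      by (simp only: doubleton_eq_iff)
    hence q_uv: "q u = p x \<and> q v = p y \<or> q u = p y \<and> q v = p x"
      using q_rep(2)[OF xy(1)] q_rep(2)[OF xy(2)] by metis
    have "label H f = label G e"
      unfolding e(2) using iso[OF e(1)] unfolding quot_simps by (rule conjunct2)
    moreover have "ends G e = {y, x}" using xy(3) by (simp only: insert_commute)
    hence "p x \<ominus>\<^bsub>R\<^esub> p y \<in> label G e" "p y \<ominus>\<^bsub>R\<^esub> p x \<in> label G e"
      using p eG xy(3) unfolding Spl_simps(1) by blast+
    ultimately show ?thesis using q_uv by metis
  qed
  moreover have "p (c v) \<in> carrier R" if "v \<in> verts H" for v
  proof -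
    have "c v \<in> verts G" using c[OF that] B root by blast
    thus ?thesis using p by auto
  qed
  hence "q \<in> verts H \<rightarrow>\<^sub>E carrier R" unfolding q_def by simp
  ultimately have "q \<in> carrier (Spl R H)" by simp
  moreover have "Spl_map G H ?\<psi> q = p"
  proof
    show "Spl_map G H ?\<psi> q v = p v" for v
    proof (cases "v \<in> verts G")
      case True
      have "proj B (Inl v) = Inl (rep B v)" "Inl v \<in> cells G"
        using True by (simp_all add: proj_vertex cells_def InlI)
      thus ?thesis using True q_rep[OF True] by (simp add: Spl_map_def)
    qed (use p in \<open>auto simp: Spl_map_def PiE_iff extensional_def\<close>)
  qed
  ultimately show ?thesis using contr by blast
qed


text \<open>
  The type of a tree edge \<open>pe v\<close> records its ideal and which endpoints of non-tree edges lie below it.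
  If \<open>v\<close> and \<open>w\<close> have the same type, the function with value \<open>a\<close> below \<open>v\<close> and \<open>- a\<close> below \<open>w\<close>
  vanishes at the endpoints of all non-tree edges, so it is a spline as soon as \<open>a\<close> lies in the common
  ideal. Subtracting it from \<open>p\<close> removes the jump at \<open>v\<close> without creating new ones.
\<close>

lemma (in cring) Spl_subset_of_few_jumps:
  fixes G :: "('v, 'e, 'a set) lgraph"
  assumes tree: "spanning_tree G r par pe rank"
    and fin: "finite S" and label: "label G \<in> edges G \<rightarrow> S" and ideals: "\<forall>I\<in>S. ideal I R"
    and gen: "genus G = int g"
    and N: "submodule N R (Spl R G)"
    and few: "\<And>p. p \<in> carrier (Spl R G) \<Longrightarrow>
      card (spanning_tree.jumps G r par p) \<le> 2 + card S * 2 ^ (2 * g) \<Longrightarrow> p \<in> N"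
  shows "carrier (Spl R G) \<subseteq> N"
proof
  interpret T: spanning_tree G r par pe rank by fact
  have idl: "\<forall>e\<in>edges G. ideal (label G e) R" using label ideals by auto
  note mod = module_Spl[OF T.wf idl]
  have N_add: "(\<lambda>v\<in>verts G. x v \<oplus> y v) \<in> N" if "x \<in> N" "y \<in> N" for x y
    using N that unfolding submodule_iff_closed[OF mod] by simp
  let ?V = "verts G - {r}"
  define U where "U = (\<Union>e\<in>edges G - pe ` ?V. ends G e)"
  define type where "type v = (label G (pe v), {x \<in> U. T.anc v x})" for v
  have ends_card: "finite (ends G e) \<and> card (ends G e) \<le> 2" if "e \<in> edges G" for e
  proof -
    obtain u v where "ends G e = {u, v}" using T.wf \<open>e \<in> edges G\<close> by (auto simp: wf_graph_def)
    thus ?thesis by (simp add: card_insert_if)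
  qed
  have fU: "finite U" unfolding U_def using T.finite_edges ends_card by auto
  have "card U \<le> (\<Sum>e\<in>edges G - pe ` ?V. card (ends G e))"
    unfolding U_def using T.finite_edges by (intro card_UN_le) auto
  also have "\<dots> \<le> (\<Sum>e\<in>edges G - pe ` ?V. 2)" using ends_card by (intro sum_mono) auto
  also have "\<dots> = 2 * g" using T.card_nontree[OF gen] by simp
  finally have cU: "card U \<le> 2 * g" .
  have ctypes: "card (S \<times> Pow U) \<le> card S * 2 ^ (2 * g)"
    using fU cU by (simp add: card_cartesian_product card_Pow)
  show "p \<in> N" if "p \<in> carrier (Spl R G)" for p
    using that
  proof (induction "card (T.jumps p)" arbitrary: p rule: less_induct)
    case less
    note p = less.prems
    have finD: "finite (T.jumps p)" using T.finite_verts by (simp add: T.jumps_def)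
    show ?case
    \<comment> \<open>The product alone suffices for the pigeonhole argument. The summand 2 ensures
      that the correction \<open>q\<close>, whose jumps lie in \<open>{v, w}\<close>, is itself
      covered by \<open>few\<close>.\<close>
    proof (cases "card (T.jumps p) \<le> 2 + card S * 2 ^ (2 * g)")
      case True
      thus ?thesis using few p by blast
    next
      case False
      hence "card (S \<times> Pow U) < card (T.jumps p)" using ctypes by simp
      moreover have "type ` T.jumps p \<subseteq> S \<times> Pow U"
        using label T.pe_edges by (auto simp: type_def T.jumps_def)
      moreover have "finite (S \<times> Pow U)" using fin fU by simp
      ultimately have "card (type ` T.jumps p) < card (T.jumps p)"
        by (meson card_mono le_less_trans)
      hence "\<not> inj_on type (T.jumps p)" by (rule pigeonhole)
      then obtain v w where vw: "v \<in> T.jumps p" "w \<in> T.jumps p" "v \<noteq> w" "type v = type w"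
        by (auto simp: inj_on_def)
      have v: "v \<in> ?V" and w: "w \<in> ?V" using vw by (auto simp: T.jumps_def)
      have pc: "p x \<in> carrier R" if "x \<in> verts G" for x using p that by auto
      define a where "a = p v \<ominus> p (par v)"
      have aI: "a \<in> label G (pe v)"
        using p T.pe_edges[OF v] T.pe_ends[OF v] unfolding a_def by simp
      have ac: "a \<in> carrier R" unfolding a_def using pc v T.par_verts[OF v] by simp
      define \<chi> where "\<chi> u x = (if T.anc u x then \<one> else \<zero>)" for u x
      have \<chi>c [simp]: "\<chi> u x \<in> carrier R" for u x by (simp add: \<chi>_def)
      have \<chi>_par: "\<chi> u (par x) = \<chi> u x" if "x \<noteq> u" for u x
        using T.anc_unfold[of u x] that by (simp add: \<chi>_def)
      have \<chi>_self: "\<chi> u u = \<one>" "\<chi> u (par u) = \<zero>" if "u \<in> ?V" for u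
        using T.anc_unfold[of u u] T.not_anc_par[OF that] by (simp_all add: \<chi>_def)
      \<comment> \<open>One of \<open>v\<close> and \<open>w\<close> may lie below the other; the
        two terms then cancel below the lower one. In every case the jump is \<open>a\<close> at
        \<open>v\<close>, \<open>-a\<close> at \<open>w\<close> and 0 at all other vertices.\<close>
      define f where "f x = a \<otimes> (\<chi> v x \<ominus> \<chi> w x)" for x
      have fc: "f x \<in> carrier R" for x unfolding f_def using ac by simp
      define q where "q = (\<lambda>x\<in>verts G. f x)"
      have f_par: "f (par x) = f x" if "x \<noteq> v" "x \<noteq> w" for x
        using that by (simp add: f_def \<chi>_par)
      have f_v: "f v \<ominus> f (par v) = a"
      proof -
        have "f v \<ominus> f (par v) = a \<otimes> (\<one> \<ominus> \<chi> w v) \<ominus> a \<otimes> (\<zero> \<ominus> \<chi> w v)"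
          using vw(3) by (simp add: f_def \<chi>_par \<chi>_self[OF v])
        also have "\<dots> = a" using ac \<chi>c[of w v] by algebra
        finally show ?thesis .
      qed
      have f_w: "f w \<ominus> f (par w) = \<ominus> a"
      proof -
        have "f w \<ominus> f (par w) = a \<otimes> (\<chi> v w \<ominus> \<one>) \<ominus> a \<otimes> (\<chi> v w \<ominus> \<zero>)"
          using vw(3) by (simp add: f_def \<chi>_par \<chi>_self[OF w])
        also have "\<dots> = \<ominus> a" using ac \<chi>c[of v w] by algebra
        finally show ?thesis .
      qed
      have f_U: "f x = \<zero>" if "x \<in> U" for x
      proof -
        have "T.anc v x \<longleftrightarrow> T.anc w x" using vw(4) that by (auto simp: type_def)
        thus ?thesis using ac by (simp add: f_def \<chi>_def minus_eq r_neg)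
      qed
      have f_edge: "f x \<ominus> f y \<in> label G e" if e: "e \<in> edges G" "ends G e = {x, y}" for e x y
      proof -
        interpret I: ideal "label G e" R using idl e by blast
        have swap: "f y' \<ominus> f x' = \<ominus> (f x' \<ominus> f y')" for x' y'
          using fc[of x'] fc[of y'] by algebra
        show ?thesis
        proof (cases "e \<in> pe ` ?V")
          case True
          then obtain z where z: "z \<in> ?V" "e = pe z" by blast
          have "f z \<ominus> f (par z) \<in> label G e"
          proof -
            consider "z = v" | "z = w" | "z \<noteq> v" "z \<noteq> w" by blast
            thus ?thesis
            proof cases
              case 1
              thus ?thesis using f_v aI z by simp
            next
              case 2
              thus ?thesis using f_w aI z vw(4) I.a_inv_closed by (simp add: type_def)
            next
              case 3
              thus ?thesis using f_par fc[of z] by (simp add: minus_eq r_neg)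
            qed
          qed
          moreover have "{x, y} = {z, par z}" using e z T.pe_ends by simp
          ultimately show ?thesis using swap[of "par z" z] I.a_inv_closed
            by (auto simp: doubleton_eq_iff)
        next
          case False
          hence "x \<in> U" "y \<in> U" using e by (auto simp: U_def)
          thus ?thesis using f_U by (simp add: minus_eq)
        qed
      qed
      have q: "q \<in> carrier (Spl R G)"
        using f_edge fc wf_graph_ends[OF T.wf] by (auto simp: q_def)
      define q' where "q' = (\<lambda>x\<in>verts G. p x \<ominus> f x)"
      have "(\<lambda>x\<in>verts G. p x \<oplus> (\<lambda>x\<in>verts G. (\<ominus> \<one>) \<otimes> q x) x) \<in> carrier (Spl R G)"
      proof -
        have "(\<ominus> \<one>) \<odot>\<^bsub>Spl R G\<^esub> q \<in> carrier (Spl R G)"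
          using module.smult_closed[OF mod _ q] by blast
        from abelian_monoid.a_closed[OF abelian_group.axioms(1)[OF module.axioms(2)[OF mod]] p this]
        show ?thesis by (simp only: Spl_simps(2,4))
      qed
      moreover have "(\<lambda>x\<in>verts G. p x \<oplus> (\<lambda>x\<in>verts G. (\<ominus> \<one>) \<otimes> q x) x) = q'"
        using fc by (auto simp: q'_def q_def l_minus minus_eq)
      ultimately have q': "q' \<in> carrier (Spl R G)" by (simp only:)
      have q'_eq: "q' x = p x \<ominus> f x" if "x \<in> verts G" for x using that by (simp add: q'_def)
      have "T.jumps q \<subseteq> {v, w}"
      proof
        fix x assume "x \<in> T.jumps q"
        hence "f x \<noteq> f (par x)" using T.par_closed by (auto simp: T.jumps_def q_def)
        thus "x \<in> {v, w}" using f_par[of x] by fastforce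
      qed
      hence "card (T.jumps q) \<le> card {v, w}" by (intro card_mono) auto
      also have "\<dots> \<le> 2 + card S * 2 ^ (2 * g)" by (simp add: card_insert_if)
      finally have qN: "q \<in> N" using few[OF q] by blast
      have "T.jumps q' \<subset> T.jumps p"
      proof
        show "T.jumps q' \<subseteq> T.jumps p"
        proof
          fix x assume x: "x \<in> T.jumps q'"
          hence xV: "x \<in> ?V" and neq: "p x \<ominus> f x \<noteq> p (par x) \<ominus> f (par x)"
            using T.par_closed q'_eq by (auto simp: T.jumps_def)
          show "x \<in> T.jumps p"
          \<comment> \<open>At \<open>w\<close> the old jump is increased by \<open>a\<close> and
            may survive, which is harmless because \<open>w\<close> is already a jump of
            \<open>p\<close>.\<close>
          proof (cases "x = v \<or> x = w")
            case False
            hence "p x \<noteq> p (par x)" using neq f_par by auto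
            thus ?thesis using xV by (simp add: T.jumps_def)
          qed (use vw in auto)
        qed
        have "p v \<ominus> f v = p (par v) \<ominus> f (par v)"
        proof -
          have c: "p v \<in> carrier R" "p (par v) \<in> carrier R" using pc v T.par_verts[OF v] by auto
          have "f v \<ominus> f (par v) = p v \<ominus> p (par v)" using f_v a_def by simp
          moreover have "p v \<ominus> f v \<ominus> (p (par v) \<ominus> f (par v))
              = (p v \<ominus> p (par v)) \<ominus> (f v \<ominus> f (par v))"
            using c fc[of v] fc[of "par v"] by algebra
          ultimately have "p v \<ominus> f v \<ominus> (p (par v) \<ominus> f (par v)) = \<zero>"
            using c by (simp add: r_neg minus_eq)
          thus ?thesis using c fc by (simp add: r_right_minus_eq)
        qed
        hence "v \<notin> T.jumps q'" using v T.par_verts[OF v] q'_eq by (simp add: T.jumps_def)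
        thus "T.jumps q' \<noteq> T.jumps p" using vw(1) by blast
      qed
      hence "card (T.jumps q') < card (T.jumps p)" by (rule psubset_card_mono[OF finD])
      hence "q' \<in> N" using less.hyps q' by blast
      hence "(\<lambda>x\<in>verts G. q' x \<oplus> q x) \<in> N" using qN by (rule N_add)
      moreover have "(\<lambda>x\<in>verts G. q' x \<oplus> q x) = p"
      proof
        have "p x \<ominus> f x \<oplus> f x = p x" if "x \<in> verts G" for x
          using pc[OF that] fc[of x] by algebra
        thus "(\<lambda>x\<in>verts G. q' x \<oplus> q x) x = p x" for x
          using p by (cases "x \<in> verts G") (auto simp: q'_def q_def PiE_iff extensional_def)
      qed
      ultimately show ?thesis by simp
    qed
  qed
qed

text \<open>The list depends only on \<open>K\<close>, hence on \<open>S\<close> and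
  \<open>g\<close>, and is fixed before any graph is given. As a span is an intersection of
  submodules, the task for a given graph is to show that each submodule containing all the pullbacks
  contains every spline with few jumps.\<close>

lemma (in cring) finite_spline_generators:
  assumes "finite S" and "\<forall>I\<in>S. ideal I R"
  shows "\<exists>\<G> :: ('v, 'e, 'a set) lgraph set. finite \<G> \<and> \<G> \<subseteq> labeled_graphs g S \<and>
    (\<forall>G\<in>labeled_graphs g S :: ('v, 'e, 'a set) lgraph set.
       module_span R (Spl R G)
         (\<Union>G'\<in>\<G>. \<Union>\<phi>\<in>{\<phi>. contraction G G' \<phi>}. Spl_map G G' \<phi> ` carrier (Spl R G'))
       = carrier (Spl R G))"
proof -
  define K where "K = 2 + card S * 2 ^ (2 * g)"
  obtain \<G> :: "('v, 'e, 'a set) lgraph set" where \<G>: "finite \<G>" "\<G> \<subseteq> labeled_graphs g S"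
    "\<And>G :: ('v, 'e, 'a set) lgraph. G \<in> labeled_graphs g S \<Longrightarrow> card (verts G) \<le> Suc K \<Longrightarrow> \<exists>H\<in>\<G>. \<exists>a b. graph_iso G H a b"
    using finite_isomorphism_classes[OF assms(1), of g "Suc K"] by blast
  have "module_span R (Spl R G)
      (\<Union>G'\<in>\<G>. \<Union>\<phi>\<in>{\<phi>. contraction G G' \<phi>}. Spl_map G G' \<phi> ` carrier (Spl R G'))
    = carrier (Spl R G)" (is "module_span R _ ?X = _")
    if G: "G \<in> labeled_graphs g S" for G :: "('v, 'e, 'a set) lgraph"
  proof
    have conn: "connected_graph G" and gen: "genus G = int g" and lab: "label G \<in> edges G \<rightarrow> S"
      using G by (auto simp: labeled_graphs_def)
    have wf: "wf_graph G" using conn by (simp add: connected_graph_def)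
    have idl: "\<forall>e\<in>edges G. ideal (label G e) R" using lab assms(2) by auto
    have "?X \<subseteq> carrier (Spl R G)"
      using Spl_map_carrier[OF _ wf idl] by (intro UN_least image_subsetI) (simp only: mem_Collect_eq)
    thus "module_span R (Spl R G) ?X \<subseteq> carrier (Spl R G)"
      using module.carrier_is_submodule[OF module_Spl[OF wf idl]]
      unfolding module_span_def by (intro Inter_lower CollectI conjI)
    obtain r par pe rank where tree: "spanning_tree G r par pe rank"
      using ex_spanning_tree[OF conn] .
    interpret T: spanning_tree G r par pe rank by fact
    have "carrier (Spl R G) \<subseteq> N" if N: "submodule N R (Spl R G)" and X: "?X \<subseteq> N" for N
    proof (rule Spl_subset_of_few_jumps[OF tree assms(1) lab assms(2) gen N])
      fix p assume p: "p \<in> carrier (Spl R G)" and few: "card (T.jumps p) \<le> 2 + card S * 2 ^ (2 * g)"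
      have sub: "T.jumps p \<subseteq> verts G - {r}" by (auto simp: T.jumps_def)
      hence "finite (T.jumps p)" using T.finite_verts finite_subset by blast
      \<comment> \<open>The successor accounts for the root, which is a vertex of the quotient but
        never a jump.\<close>
      hence "card (verts (T.quot (T.jumps p))) \<le> Suc K"
        using few by (simp add: K_def card_insert_if)
      then obtain H a b where H: "H \<in> \<G>" "graph_iso (T.quot (T.jumps p)) H a b"
        using \<G>(3)[OF T.quot_labeled_graph[OF sub G]] by blast
      obtain \<psi> where "contraction G H \<psi>" "p \<in> Spl_map G H \<psi> ` carrier (Spl R H)"
        using Spl_pullback_of_bounded[OF tree p H(2)] by (elim exE conjE)
      hence "p \<in> ?X" using H(1) by (intro UN_I CollectI)
      thus "p \<in> N" by (rule subsetD[OF X])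
    qed
    thus "carrier (Spl R G) \<subseteq> module_span R (Spl R G) ?X"
      unfolding module_span_def by (intro Inter_greatest) simp
  qed
  thus ?thesis using \<G>(1,2) by (intro exI[of _ \<G>] conjI ballI)
qed

theorem theorem1p2:
  fixes R :: "('a, 'b) ring_scheme"
    and S :: "'a set set"
    and g :: nat
  assumes "cring R" and "noetherian_ring R"
    and "finite S" and "\<forall>I\<in>S. ideal I R"
  shows "fg_gop_module R g S (Spl R :: ('v, 'e, 'a set) lgraph \<Rightarrow> _) Spl_map \<and>
    (\<exists>\<G> :: ('v, 'e, 'a set) lgraph set.
       finite \<G> \<and> \<G> \<subseteq> labeled_graphs g S \<and>
       (\<forall>G :: ('v, 'e, 'a set) lgraph. G \<in> labeled_graphs g S \<longrightarrow>
          module_span R (Spl R G)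
            (\<Union>G'\<in>\<G>. \<Union>\<phi>\<in>{\<phi>. contraction G G' \<phi>}. Spl_map G G' \<phi> ` carrier (Spl R G'))
          = carrier (Spl R G)))"
proof -
  note gen = cring.finite_spline_generators[OF assms(1,3,4), where ?'v = 'v and ?'e = 'e and g = g]
  have "gop_module R g S (Spl R :: ('v, 'e, 'a set) lgraph \<Rightarrow> _) Spl_map"
    by (rule cring.gop_module_Spl[OF assms(1,2,4)])
  hence "fg_gop_module R g S (Spl R :: ('v, 'e, 'a set) lgraph \<Rightarrow> _) Spl_map"
    unfolding fg_gop_module_def using gen by (rule conjI)
  thus ?thesis using gen unfolding Ball_def by (rule conjI)
qed

end
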